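(* Let $N\ge 1$ and $r\ge 1$ be integers and consider the coupled system $$\dot{\mathbf{x}}^i_j=\bar f^i_j(\mathbf{x}^i_1,\dots,\mathbf{x}^i_{j+1})+\Delta^i_j(\mathbf{x}),\quad j=1,\dots,r-1,\qquad \dot{\mathbf{x}}^i_r=\bar f^i_r(\mathbf{x}^i_1,\dots,\mathbf{x}^i_r,\mathbf{u}^i)+\Delta^i_r(\mathbf{x}),$$ for $i=1,\dots,N$, where the uncoupled dynamics are regular at the operating point $(\mathbf{x}^*,\mathbf{u}^* )$ (see context). Suppose that on a neighborhood of $(\mathbf{x}^*,\mathbf{u}^* )$ the coupling $\Delta$ is lower-triangular. Then there is an open neighborhood $\mathcal{X}$ of $(\mathbf{x}^*,\mathbf{u}^* )$ on which the joint system is differentially flat, and a flat output is $\mathbf{y}=(\mathbf{x}^1_1,\mathbf{x}^2_1,\dots,\mathbf{x}^N_1)$, i.e. the concatenation of the first-order substates of all subsystems.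
   Context: Setup. There are $N$ subsystems. Subsystem $i$ has input $\mathbf{u}^i\in\mathbb{R}^{m_i}$ and state $\mathbf{x}^i=(\mathbf{x}^i_1,\dots,\mathbf{x}^i_r)\in\mathbb{R}^{rm_i}$ with $\mathbf{x}^i_j\in\mathbb{R}^{m_i}$. The joint state is $\mathbf{x}=(\mathbf{x}^1,\dots,\mathbf{x}^N)$ and the joint input is $\mathbf{u}=(\mathbf{u}^1,\dots,\mathbf{u}^N)$. Write $\mathbf{x}_j=(\mathbf{x}^1_j,\dots,\mathbf{x}^N_j)$ for the $j$-th order substates of all subsystems, $\mathbf{x}_{\le j}=(\mathbf{x}_1,\dots,\mathbf{x}_j)$, and $\mathbf{x}^{<i}_{j+1}=(\mathbf{x}^1_{j+1},\dots,\mathbf{x}^{i-1}_{j+1})$, which is empty when $i=1$. The uncoupled dynamics $\bar f^i=(\bar f^i_1,\dots,\bar f^i_r)$ are in pure-feedback form as displayed in the claim, with $\Delta\equiv 0$. Regularity (Assumption 1). Each $\bar f^i_j$ is smooth on a neighborhood of the operating point $(\mathbf{x}^*,\mathbf{u}^* )$. At the operating point, $\det D_{\mathbf{x}^i_{j+1}}\bar f^i_j\neq 0$ for $j=1,\dots,r-1$, and $\det D_{\mathbf{u}^i}\bar f^i_r\neq 0$. Lower-triangular coupling on a set $\mathcal{X}$. Each $\Delta^i_j$ is smooth, and there are functions $\bar\Delta^i_j$ such that $\Delta^i_j(\mathbf{x})=\bar\Delta^i_j(\mathbf{x}_{\le j},\mathbf{x}^{<i}_{j+1})$ for all $(\mathbf{x},\mathbf{u})\in\mathcal{X}$.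 In words, $\Delta^i_j$ depends only on substates of order at most $j$ of all subsystems, and on substates of order $j+1$ of subsystems with index smaller than $i$. Differential flatness. A system $\dot{\mathbf{x}}=f(\mathbf{x},\mathbf{u})$ is differentially flat with flat output $\mathbf{y}$ if two conditions hold. First, $\mathbf{y}$ is a smooth function of $\mathbf{x}$, $\mathbf{u}$ and finitely many derivatives of $\mathbf{u}$. Second, there exist smooth maps $\Phi,\Psi$ and an integer $\beta$ such that, along trajectories, $\mathbf{x}=\Phi(\mathbf{y},\dot{\mathbf{y}},\dots,\mathbf{y}^{(\beta)})$ and $\mathbf{u}=\Psi(\mathbf{y},\dot{\mathbf{y}},\dots,\mathbf{y}^{(\beta)})$. *)

theory Defs
  imports "HOL-Analysis.Analysis" "Jordan_Normal_Form.Determinant"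
begin

text \<open>A point of R^V (V a finite set of coordinate names) is an assignment
  a :: 'v => real that vanishes outside V.\<close>

definition pts :: "'v set \<Rightarrow> ('v \<Rightarrow> real) set" where
  "pts V = {a. \<forall>v. v \<notin> V \<longrightarrow> a v = 0}"

definition restr :: "'v set \<Rightarrow> ('v \<Rightarrow> real) \<Rightarrow> ('v \<Rightarrow> real)" where
  "restr A a = (\<lambda>v. if v \<in> A then a v else 0)"

definition opn :: "'v set \<Rightarrow> ('v \<Rightarrow> real) set \<Rightarrow> bool" where
  "opn V S \<longleftrightarrow> S \<subseteq> pts V \<and>
     (\<forall>a\<in>S. \<exists>e>0. \<forall>b\<in>pts V. (\<forall>v\<in>V. \<bar>b v - a v\<bar> < e) \<longrightarrow> b \<in> S)"

definition cont_on :: "'v set \<Rightarrow> ('v \<Rightarrow> real) set \<Rightarrow> (('v \<Rightarrow> real) \<Rightarrow> real) \<Rightarrow> bool" where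
  "cont_on V S g \<longleftrightarrow> (\<forall>a\<in>S. \<forall>e>0. \<exists>d>0. \<forall>b\<in>S.
      (\<forall>v\<in>V. \<bar>b v - a v\<bar> < d) \<longrightarrow> \<bar>g b - g a\<bar> < e)"

definition pdiff :: "(('v \<Rightarrow> real) \<Rightarrow> real) \<Rightarrow> 'v \<Rightarrow> ('v \<Rightarrow> real) \<Rightarrow> real" where
  "pdiff g v a = deriv (\<lambda>h. g (a(v := a v + h))) 0"

fun ck_on :: "nat \<Rightarrow> 'v set \<Rightarrow> ('v \<Rightarrow> real) set \<Rightarrow> (('v \<Rightarrow> real) \<Rightarrow> real) \<Rightarrow> bool" where
  "ck_on 0 V S g = cont_on V S g"
| "ck_on (Suc n) V S g = (cont_on V S g \<and>
     (\<forall>v\<in>V. (\<forall>a\<in>S. (\<lambda>h. g (a(v := a v + h))) field_differentiable (at 0))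
            \<and> ck_on n V S (pdiff g v)))"

definition smooth_on :: "'v set \<Rightarrow> ('v \<Rightarrow> real) set \<Rightarrow> (('v \<Rightarrow> real) \<Rightarrow> real) \<Rightarrow> bool" where
  "smooth_on V S g \<longleftrightarrow> (\<forall>n. ck_on n V S g)"

definition smooth_time :: "real set \<Rightarrow> (real \<Rightarrow> real) \<Rightarrow> bool" where
  "smooth_time T g \<longleftrightarrow> (\<forall>n. \<forall>t\<in>T. ((deriv ^^ n) g) field_differentiable (at t))"

definition xu :: "('s \<Rightarrow> real) \<Rightarrow> ('i \<Rightarrow> real) \<Rightarrow> ('s + 'i \<Rightarrow> real)" where
  "xu x u = case_sum x u"

definition trajectory ::
  "'s set \<Rightarrow> 'i set \<Rightarrow> (('s \<Rightarrow> real) \<Rightarrow> ('i \<Rightarrow> real) \<Rightarrow> 's \<Rightarrow> real) \<Rightarrow> ('s + 'i \<Rightarrow> real) set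
   \<Rightarrow> real set \<Rightarrow> (real \<Rightarrow> 's \<Rightarrow> real) \<Rightarrow> (real \<Rightarrow> 'i \<Rightarrow> real) \<Rightarrow> bool" where
  "trajectory SV IV F X T x u \<longleftrightarrow> open T \<and>
     (\<forall>t\<in>T. x t \<in> pts SV \<and> u t \<in> pts IV \<and> xu (x t) (u t) \<in> X) \<and>
     (\<forall>v\<in>IV. smooth_time T (\<lambda>s. u s v)) \<and>
     (\<forall>v\<in>SV. \<forall>t\<in>T. ((\<lambda>s. x s v) has_real_derivative F (x t) (u t) v) (at t))"

definition jetvars :: "nat \<Rightarrow> 'o set \<Rightarrow> (nat \<times> 'o) set" where
  "jetvars \<beta> OV = {(l, q). l \<le> \<beta> \<and> q \<in> OV}"

definition jet :: "nat \<Rightarrow> 'o set \<Rightarrow> (real \<Rightarrow> 'o \<Rightarrow> real) \<Rightarrow> real \<Rightarrow> (nat \<times> 'o \<Rightarrow> real)" where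
  "jet \<beta> OV y t = (\<lambda>(l, q). if l \<le> \<beta> \<and> q \<in> OV then (deriv ^^ l) (\<lambda>s. y s q) t else 0)"

definition diff_flat_on ::
  "'s set \<Rightarrow> 'i set \<Rightarrow> 'o set \<Rightarrow> (('s \<Rightarrow> real) \<Rightarrow> ('i \<Rightarrow> real) \<Rightarrow> 's \<Rightarrow> real)
   \<Rightarrow> ('s + 'i \<Rightarrow> real) set \<Rightarrow> (('s \<Rightarrow> real) \<Rightarrow> ('i \<Rightarrow> real) \<Rightarrow> 'o \<Rightarrow> real) \<Rightarrow> bool" where
  "diff_flat_on SV IV OV F X h \<longleftrightarrow>
     (\<forall>q\<in>OV. smooth_on (SV <+> IV) X (\<lambda>z. h (z \<circ> Inl) (z \<circ> Inr) q)) \<and>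
     (\<exists>\<beta> (\<Phi> :: (nat \<times> 'o \<Rightarrow> real) \<Rightarrow> 's \<Rightarrow> real) (\<Psi> :: (nat \<times> 'o \<Rightarrow> real) \<Rightarrow> 'i \<Rightarrow> real) W.
        opn (jetvars \<beta> OV) W \<and>
        (\<forall>v\<in>SV. smooth_on (jetvars \<beta> OV) W (\<lambda>w. \<Phi> w v)) \<and>
        (\<forall>v\<in>IV. smooth_on (jetvars \<beta> OV) W (\<lambda>w. \<Psi> w v)) \<and>
        (\<forall>T x u. trajectory SV IV F X T x u \<longrightarrow>
           (\<forall>t\<in>T. jet \<beta> OV (\<lambda>s. h (x s) (u s)) t \<in> W \<and>
                  (\<forall>v\<in>SV. x t v = \<Phi> (jet \<beta> OV (\<lambda>s. h (x s) (u s)) t) v) \<and>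
                  (\<forall>v\<in>IV. u t v = \<Psi> (jet \<beta> OV (\<lambda>s. h (x s) (u s)) t) v))))"

text \<open>State coordinates (i,j,k): subsystem i < N, order j in 1..r, component k < m i.
  Input coordinates (i,k): subsystem i < N, component k < m i.\<close>

definition SV :: "nat \<Rightarrow> nat \<Rightarrow> (nat \<Rightarrow> nat) \<Rightarrow> (nat \<times> nat \<times> nat) set" where
  "SV N r m = {(i, j, k). i < N \<and> 1 \<le> j \<and> j \<le> r \<and> k < m i}"

definition IV :: "nat \<Rightarrow> (nat \<Rightarrow> nat) \<Rightarrow> (nat \<times> nat) set" where
  "IV N m = {(i, k). i < N \<and> k < m i}"

definition pure_feedback :: "nat \<Rightarrow> nat \<Rightarrow> (nat \<Rightarrow> nat)
   \<Rightarrow> (nat \<Rightarrow> nat \<Rightarrow> nat \<Rightarrow> (nat \<times> nat \<times> nat \<Rightarrow> real) \<Rightarrow> (nat \<times> nat \<Rightarrow> real) \<Rightarrow> real) \<Rightarrow> bool" where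
  "pure_feedback N r m fbar \<longleftrightarrow>
     (\<forall>i<N. \<forall>j. 1 \<le> j \<and> j < r \<longrightarrow> (\<forall>k<m i. \<forall>x u.
        fbar i j k x u = fbar i j k (restr {(i', j', l). i' = i \<and> 1 \<le> j' \<and> j' \<le> j + 1 \<and> l < m i} x)
                                    (restr {} u))) \<and>
     (\<forall>i<N. \<forall>k<m i. \<forall>x u.
        fbar i r k x u = fbar i r k (restr {(i', j', l). i' = i \<and> 1 \<le> j' \<and> j' \<le> r \<and> l < m i} x)
                                    (restr {(i', l). i' = i \<and> l < m i} u))"

definition regular :: "nat \<Rightarrow> nat \<Rightarrow> (nat \<Rightarrow> nat)
   \<Rightarrow> (nat \<Rightarrow> nat \<Rightarrow> nat \<Rightarrow> (nat \<times> nat \<times> nat \<Rightarrow> real) \<Rightarrow> (nat \<times> nat \<Rightarrow> real) \<Rightarrow> real)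
   \<Rightarrow> (nat \<times> nat \<times> nat \<Rightarrow> real) \<Rightarrow> (nat \<times> nat \<Rightarrow> real) \<Rightarrow> bool" where
  "regular N r m fbar xs us \<longleftrightarrow>
     (\<forall>i<N. \<forall>j. 1 \<le> j \<and> j \<le> r \<longrightarrow> (\<exists>U. opn (SV N r m <+> IV N m) U \<and> xu xs us \<in> U \<and>
        (\<forall>k<m i. smooth_on (SV N r m <+> IV N m) U (\<lambda>z. fbar i j k (z \<circ> Inl) (z \<circ> Inr))))) \<and>
     (\<forall>i<N. \<forall>j. 1 \<le> j \<and> j < r \<longrightarrow>
        det (mat (m i) (m i) (\<lambda>(k, l).
           pdiff (\<lambda>z. fbar i j k (z \<circ> Inl) (z \<circ> Inr)) (Inl (i, j + 1, l)) (xu xs us))) \<noteq> 0) \<and>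
     (\<forall>i<N. det (mat (m i) (m i) (\<lambda>(k, l).
           pdiff (\<lambda>z. fbar i r k (z \<circ> Inl) (z \<circ> Inr)) (Inr (i, l)) (xu xs us))) \<noteq> 0)"

definition LTvars :: "nat \<Rightarrow> nat \<Rightarrow> (nat \<Rightarrow> nat) \<Rightarrow> nat \<Rightarrow> nat \<Rightarrow> (nat \<times> nat \<times> nat) set" where
  "LTvars N r m i j = {(i', j', l). i' < N \<and> l < m i' \<and> 1 \<le> j' \<and>
       (j' \<le> j \<or> (j' = j + 1 \<and> j + 1 \<le> r \<and> i' < i))}"

definition lower_triangular :: "nat \<Rightarrow> nat \<Rightarrow> (nat \<Rightarrow> nat)
   \<Rightarrow> (nat \<Rightarrow> nat \<Rightarrow> nat \<Rightarrow> (nat \<times> nat \<times> nat \<Rightarrow> real) \<Rightarrow> real)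
   \<Rightarrow> (nat \<times> nat \<times> nat + nat \<times> nat \<Rightarrow> real) set \<Rightarrow> bool" where
  "lower_triangular N r m \<Delta> X \<longleftrightarrow>
     (\<forall>i<N. \<forall>j. 1 \<le> j \<and> j \<le> r \<longrightarrow> (\<forall>k<m i. smooth_on (SV N r m) (pts (SV N r m)) (\<Delta> i j k))) \<and>
     (\<exists>\<Delta>bar. \<forall>i<N. \<forall>j. 1 \<le> j \<and> j \<le> r \<longrightarrow> (\<forall>k<m i. \<forall>z\<in>X.
         \<Delta> i j k (z \<circ> Inl) = \<Delta>bar i j k (restr (LTvars N r m i j) (z \<circ> Inl))))"

definition coupled_dyn :: "(nat \<Rightarrow> nat \<Rightarrow> nat \<Rightarrow> (nat \<times> nat \<times> nat \<Rightarrow> real) \<Rightarrow> (nat \<times> nat \<Rightarrow> real) \<Rightarrow> real)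
   \<Rightarrow> (nat \<Rightarrow> nat \<Rightarrow> nat \<Rightarrow> (nat \<times> nat \<times> nat \<Rightarrow> real) \<Rightarrow> real)
   \<Rightarrow> (nat \<times> nat \<times> nat \<Rightarrow> real) \<Rightarrow> (nat \<times> nat \<Rightarrow> real) \<Rightarrow> (nat \<times> nat \<times> nat \<Rightarrow> real)" where
  "coupled_dyn fbar \<Delta> x u = (\<lambda>(i, j, k). fbar i j k x u + \<Delta> i j k x)"

definition first_substates :: "nat \<Rightarrow> (nat \<Rightarrow> nat)
   \<Rightarrow> (nat \<times> nat \<times> nat \<Rightarrow> real) \<Rightarrow> (nat \<times> nat \<Rightarrow> real) \<Rightarrow> (nat \<times> nat \<Rightarrow> real)" where
  "first_substates N m x u = (\<lambda>(i, k). if i < N \<and> k < m i then x (i, 1, k) else 0)"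

end

theory Submission
  imports Defs
begin

text \<open>
  By triangularity, the \<open>l\<close>-th time derivative of the output along a trajectory is, for \<open>l \<le> r\<close>, a
  smooth function of the substates of order at most \<open>l + 1\<close>, where the input counts as order
  \<open>r + 1\<close>: it is the \<open>l\<close>-fold Lie derivative of the output, and the input does not enter before
  \<open>l = r\<close>. Hence \<open>(x, u) \<mapsto> (y, y', \<dots>, y\<^bsup>(r)\<^esup>)\<close> is a smooth map between spaces of equal dimension.
  Its Jacobian is block lower triangular in the order, and the diagonal block of order \<open>l + 1\<close> is the
  product of the matrices \<open>\<partial>F\<^sub>j / \<partial>x\<^sub>j\<^sub>+\<^sub>1\<close> with \<open>j \<le> l\<close>, each of which is block lower triangular in the
  subsystem index with invertible diagonal blocks. By the inverse function theorem the map is a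
  diffeomorphism from a box around the operating point onto an open set of jets, and its inverse
  is the pair \<open>(\<Phi>, \<Psi>)\<close>, with \<open>\<beta> = r\<close>.
  The dimension of the phase space is a term and not a type, so the inverse function theorem is
  needed on the coordinate spaces \<open>pts V\<close>: Newton's method with the fixed matrix
  \<open>DF(p)\<^sup>-\<^sup>1\<close> gives injectivity and openness, and Cramer's rule the smoothness of the inverse.
\<close>

section \<open>Neighbourhoods in coordinate spaces\<close>

definition bx :: "'v set \<Rightarrow> ('v \<Rightarrow> real) \<Rightarrow> real \<Rightarrow> ('v \<Rightarrow> real) set" where
  "bx V a e = {b \<in> pts V. \<forall>v\<in>V. \<bar>b v - a v\<bar> < e}"

text \<open>Encoded as a filter so that the general limit theorems apply to functions on
  \<open>S\<close>. The centre is not removed, hence convergence of \<open>g\<close> to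
  \<open>g a\<close> along this filter is continuity at \<open>a\<close> relative to
  \<open>S\<close>.\<close>

definition nbh :: "'v set \<Rightarrow> ('v \<Rightarrow> real) set \<Rightarrow> ('v \<Rightarrow> real) \<Rightarrow> ('v \<Rightarrow> real) filter" where
  "nbh V S a = (INF d\<in>{0<..}. principal {b\<in>S. \<forall>v\<in>V. \<bar>b v - a v\<bar> < d})"

lemma eventually_nbh:
  "eventually P (nbh V S a) \<longleftrightarrow> (\<exists>d>0. \<forall>b\<in>S. (\<forall>v\<in>V. \<bar>b v - a v\<bar> < d) \<longrightarrow> P b)"
proof -
  have "eventually P (nbh V S a) \<longleftrightarrow>
      (\<exists>d\<in>{0<..}. eventually P (principal {b\<in>S. \<forall>v\<in>V. \<bar>b v - a v\<bar> < d}))"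
    unfolding nbh_def
  proof (rule eventually_INF_base)
    show "{0::real<..} \<noteq> {}" by (simp add: greaterThan_non_empty)
    fix d e :: real assume "d \<in> {0<..}" "e \<in> {0<..}"
    then show "\<exists>x\<in>{0<..}. principal {b\<in>S. \<forall>v\<in>V. \<bar>b v - a v\<bar> < x} \<le>
        inf (principal {b\<in>S. \<forall>v\<in>V. \<bar>b v - a v\<bar> < d}) (principal {b\<in>S. \<forall>v\<in>V. \<bar>b v - a v\<bar> < e})"
      by (intro bexI[of _ "min d e"]) auto
  qed
  then show ?thesis unfolding Bex_def by (auto simp: eventually_principal)
qed

lemma cont_on_iff_tendsto: "cont_on V S g \<longleftrightarrow> (\<forall>a\<in>S. (g \<longlongrightarrow> g a) (nbh V S a))"
  unfolding cont_on_def tendsto_iff eventually_nbh dist_real_def by blast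

lemma cont_onI: "(\<And>a. a \<in> S \<Longrightarrow> (g \<longlongrightarrow> g a) (nbh V S a)) \<Longrightarrow> cont_on V S g"
  by (simp add: cont_on_iff_tendsto)

lemma cont_onD: "cont_on V S g \<Longrightarrow> a \<in> S \<Longrightarrow> (g \<longlongrightarrow> g a) (nbh V S a)"
  by (simp add: cont_on_iff_tendsto)

lemma tendsto_nbh_coord: "v \<in> V \<Longrightarrow> ((\<lambda>b. b v) \<longlongrightarrow> a v) (nbh V S a)"
  unfolding tendsto_iff eventually_nbh dist_real_def by blast

lemma eventually_nbh_self: "eventually (\<lambda>b. b \<in> S) (nbh V S a)"
  unfolding eventually_nbh by (intro exI[of _ 1]) auto

text \<open>Finiteness of \<open>V\<close> lets the coordinatewise bounds hold simultaneously, which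
  reduces limits in a coordinate space to limits of real functions.\<close>

lemma filterlim_nbh:
  assumes "finite V" and "eventually (\<lambda>s. c s \<in> S) F" and "\<And>v. v \<in> V \<Longrightarrow> ((\<lambda>s. c s v) \<longlongrightarrow> a v) F"
  shows "filterlim c (nbh V S a) F"
  unfolding filterlim_iff
proof (intro allI impI)
  fix P assume "eventually P (nbh V S a)"
  then obtain d where d: "d > 0" "\<forall>b\<in>S. (\<forall>v\<in>V. \<bar>b v - a v\<bar> < d) \<longrightarrow> P b"
    unfolding eventually_nbh by blast
  have "\<forall>v\<in>V. eventually (\<lambda>s. \<bar>c s v - a v\<bar> < d) F"
    using assms(3) d(1) unfolding tendsto_iff dist_real_def by blast
  then have "eventually (\<lambda>s. \<forall>v\<in>V. \<bar>c s v - a v\<bar> < d) F"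
    by (rule eventually_ball_finite[OF assms(1)])
  with assms(2) show "eventually (\<lambda>s. P (c s)) F"
    by eventually_elim (use d(2) in blast)
qed

section \<open>Open sets of a coordinate space\<close>

lemma bx_sub_pts: "bx V a e \<subseteq> pts V"
  by (auto simp: bx_def)

lemma opn_iff_bx: "opn V S \<longleftrightarrow> S \<subseteq> pts V \<and> (\<forall>a\<in>S. \<exists>e>0. bx V a e \<subseteq> S)"
  unfolding opn_def bx_def by blast

lemma opn_bxE:
  assumes "opn V S" "a \<in> S" obtains e where "e > 0" "bx V a e \<subseteq> S"
  using assms unfolding opn_iff_bx by blast

lemma opn_ptsD: "opn V S \<Longrightarrow> a \<in> S \<Longrightarrow> a \<in> pts V"
  by (auto simp: opn_def)

lemma bx_self: "a \<in> pts V \<Longrightarrow> e > 0 \<Longrightarrow> a \<in> bx V a e"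
  by (simp add: bx_def)

lemma opn_iff_eventually:
  "opn V S \<longleftrightarrow> S \<subseteq> pts V \<and> (\<forall>a\<in>S. eventually (\<lambda>b. b \<in> S) (nbh V (pts V) a))"
  unfolding opn_def eventually_nbh by blast

text \<open>A small box around a point of an open \<open>S\<close> stays in \<open>S\<close>. Limits
  relative to \<open>S\<close> can thus be read as statements about full boxes, and
  conversely.\<close>

lemma nbh_opn: "opn V S \<Longrightarrow> a \<in> S \<Longrightarrow> nbh V S a = nbh V (pts V) a"
proof (rule antisym)
  assume S: "opn V S" "a \<in> S"
  show "nbh V S a \<le> nbh V (pts V) a"
    unfolding le_filter_def eventually_nbh using S(1) by (auto simp: opn_def subset_iff)
  show "nbh V (pts V) a \<le> nbh V S a"
    unfolding le_filter_def
  proof (intro allI impI)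
    fix P assume P: "eventually P (nbh V S a)"
    have "eventually (\<lambda>b. b \<in> S) (nbh V (pts V) a)" using S by (simp add: opn_iff_eventually)
    moreover have "eventually (\<lambda>b. b \<in> S \<longrightarrow> P b) (nbh V (pts V) a)"
      using P unfolding eventually_nbh by blast
    ultimately show "eventually P (nbh V (pts V) a)" by eventually_elim blast
  qed
qed

lemma opn_bx:
  assumes "finite V" shows "opn V (bx V a e)"
  unfolding opn_iff_eventually
proof (intro conjI ballI)
  fix b assume b: "b \<in> bx V a e"
  have "\<forall>v\<in>V. eventually (\<lambda>c. \<bar>c v - a v\<bar> < e) (nbh V (pts V) b)"
  proof
    fix v assume v: "v \<in> V"
    have "((\<lambda>c. \<bar>c v - a v\<bar>) \<longlongrightarrow> \<bar>b v - a v\<bar>) (nbh V (pts V) b)"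
      by (intro tendsto_intros tendsto_nbh_coord v)
    then show "eventually (\<lambda>c. \<bar>c v - a v\<bar> < e) (nbh V (pts V) b)"
      using b v by (intro order_tendstoD) (auto simp: bx_def)
  qed
  then have "eventually (\<lambda>c. \<forall>v\<in>V. \<bar>c v - a v\<bar> < e) (nbh V (pts V) b)"
    by (rule eventually_ball_finite[OF assms])
  with eventually_nbh_self show "eventually (\<lambda>c. c \<in> bx V a e) (nbh V (pts V) b)"
    by eventually_elim (simp add: bx_def)
qed (use bx_sub_pts in blast)

lemma opn_pts: "opn V (pts V)"
  unfolding opn_def by (auto intro: exI[of _ 1])

lemma opn_Int: "opn V S \<Longrightarrow> opn V T \<Longrightarrow> opn V (S \<inter> T)"
  unfolding opn_iff_eventually by (auto simp: eventually_conj_iff)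

text \<open>The factor \<open>pts V\<close> is the value for an empty index set, where the bare
  intersection would be the whole type.\<close>

lemma opn_finite_INT:
  "finite I \<Longrightarrow> (\<And>i. i \<in> I \<Longrightarrow> opn V (U i)) \<Longrightarrow> opn V (pts V \<inter> (\<Inter>i\<in>I. U i))"
proof (induction I rule: finite_induct)
  case (insert x F)
  have eq: "pts V \<inter> (\<Inter>i\<in>insert x F. U i) = U x \<inter> (pts V \<inter> (\<Inter>i\<in>F. U i))"
    by auto
  show ?case unfolding eq by (rule opn_Int) (use insert in simp_all)
qed (simp add: opn_pts)

lemma opn_preimage:
  assumes "opn V S" "cont_on V S g" "open O'"
  shows "opn V {a\<in>S. g a \<in> O'}"
  unfolding opn_iff_eventually
proof (intro conjI ballI)
  fix a assume "a \<in> {a\<in>S. g a \<in> O'}"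
  then have a: "a \<in> S" "g a \<in> O'" by auto
  have "eventually (\<lambda>b. g b \<in> O') (nbh V S a)"
    using topological_tendstoD[OF cont_onD[OF assms(2) a(1)] assms(3) a(2)] .
  with eventually_nbh_self show "eventually (\<lambda>b. b \<in> {a\<in>S. g a \<in> O'}) (nbh V (pts V) a)"
    unfolding nbh_opn[OF assms(1) a(1), symmetric] by eventually_elim simp
qed (use assms(1) in \<open>auto simp: opn_def\<close>)

lemma upd_in_pts: "a \<in> pts V \<Longrightarrow> v \<in> V \<Longrightarrow> a(v := x) \<in> pts V"
  by (auto simp: pts_def)

text \<open>Stated for \<open>nhds 0\<close> and not for \<open>at 0\<close>, since the congruence
  rules for derivatives ask for agreement at \<open>h = 0\<close> as well.\<close>

lemma eventually_upd:
  assumes "opn V S" "a \<in> S" "v \<in> V"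
  shows "eventually (\<lambda>h. a(v := a v + h) \<in> S) (nhds 0)"
proof -
  obtain e where e: "e > 0" "bx V a e \<subseteq> S" by (rule opn_bxE[OF assms(1,2)])
  have "eventually (\<lambda>h::real. \<bar>h\<bar> < e) (nhds 0)"
    unfolding eventually_nhds_metric using e(1) by (auto simp: dist_real_def)
  then show ?thesis
  proof eventually_elim
    case (elim h)
    then have "a(v := a v + h) \<in> bx V a e"
      using e(1) upd_in_pts[OF opn_ptsD[OF assms(1,2)] assms(3)] by (auto simp: bx_def)
    then show ?case using e(2) by blast
  qed
qed

section \<open>Calculus of continuously differentiable functions\<close>

lemma pdiff_eqI:
  "((\<lambda>h. g (a(v := a v + h))) has_real_derivative D) (at 0) \<Longrightarrow> pdiff g v a = D"
  unfolding pdiff_def by (rule DERIV_imp_deriv)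

lemma ck_on_cont: "ck_on n V S g \<Longrightarrow> cont_on V S g"
  by (cases n) auto

lemma ck_on_pderiv:
  "ck_on (Suc n) V S g \<Longrightarrow> v \<in> V \<Longrightarrow> a \<in> S \<Longrightarrow>
    ((\<lambda>h. g (a(v := a v + h))) has_real_derivative pdiff g v a) (at 0)"
  by (simp add: pdiff_def DERIV_deriv_iff_field_differentiable)

lemma ck_on_pdiff: "ck_on (Suc n) V S g \<Longrightarrow> v \<in> V \<Longrightarrow> ck_on n V S (pdiff g v)"
  by simp

lemma ck_on_Suc_imp: "ck_on (Suc n) V S g \<Longrightarrow> ck_on n V S g"
  by (induction n arbitrary: g) auto

lemma cont_on_subset:
  assumes "cont_on V S g" "S' \<subseteq> S" shows "cont_on V S' g"
proof (rule cont_onI)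
  fix a assume "a \<in> S'"
  moreover have "nbh V S' a \<le> nbh V S a"
    unfolding le_filter_def eventually_nbh using assms(2) by (meson subsetD)
  ultimately show "(g \<longlongrightarrow> g a) (nbh V S' a)"
    using assms cont_onD[OF assms(1)] tendsto_mono by blast
qed

lemma ck_on_subset: "ck_on n V S g \<Longrightarrow> S' \<subseteq> S \<Longrightarrow> ck_on n V S' g"
  by (induction n arbitrary: g) (auto intro: cont_on_subset)

lemma pderiv_cong:
  assumes "opn V S" "a \<in> S" "v \<in> V" "\<And>b. b \<in> S \<Longrightarrow> f b = g b"
  shows "((\<lambda>h. f (a(v := a v + h))) has_real_derivative D) (at 0) \<longleftrightarrow>
         ((\<lambda>h. g (a(v := a v + h))) has_real_derivative D) (at 0)"
proof (rule DERIV_cong_ev)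
  show "eventually (\<lambda>h. f (a(v := a v + h)) = g (a(v := a v + h))) (nhds 0)"
    using eventually_upd[OF assms(1-3)] by eventually_elim (rule assms(4))
qed auto

lemma pdiff_cong:
  assumes "opn V S" "a \<in> S" "v \<in> V" "\<And>b. b \<in> S \<Longrightarrow> f b = g b"
  shows "pdiff f v a = pdiff g v a"
  unfolding pdiff_def
  by (rule deriv_cong_ev)
     (use eventually_upd[OF assms(1-3)] in \<open>auto elim!: eventually_mono simp: assms(4)\<close>)

lemma cont_on_cong: "(\<And>b. b \<in> S \<Longrightarrow> f b = g b) \<Longrightarrow> cont_on V S f \<Longrightarrow> cont_on V S g"
  unfolding cont_on_def by simp

text \<open>Openness of \<open>S\<close> makes the difference quotients at a point of
  \<open>S\<close> see only values on \<open>S\<close>, so the partial derivatives agree on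
  \<open>S\<close> too and the induction applies to them.\<close>

lemma ck_on_cong:
  assumes "opn V S" "\<And>b. b \<in> S \<Longrightarrow> f b = g b" "ck_on n V S f"
  shows "ck_on n V S g"
  using assms(2,3)
proof (induction n arbitrary: f g)
  case 0
  then show ?case using cont_on_cong[of S f g V] by simp
next
  case (Suc n)
  have "cont_on V S g" using Suc.prems cont_on_cong[of S f g V] by simp
  moreover have "(\<lambda>h. g (a(v := a v + h))) field_differentiable (at 0)" if "v \<in> V" "a \<in> S" for v a
    unfolding field_differentiable_def
    by (rule exI[of _ "pdiff f v a"])
       (rule iffD1[OF pderiv_cong[where f = f, OF assms(1) that(2,1) Suc.prems(1)] ck_on_pderiv[OF Suc.prems(2) that]])
  moreover have "ck_on n V S (pdiff g v)" if "v \<in> V" for v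
    by (rule Suc.IH[of "pdiff f v"])
       (use that Suc.prems pdiff_cong[OF assms(1) _ that Suc.prems(1)] in auto)
  ultimately show ?case by simp
qed

text \<open>Lets an induction step name the partial derivatives explicitly as \<open>D\<close>
  instead of computing with \<open>deriv\<close>.\<close>

lemma ck_on_SucI:
  assumes "opn V S" "cont_on V S g"
    and "\<And>v a. v \<in> V \<Longrightarrow> a \<in> S \<Longrightarrow> ((\<lambda>h. g (a(v := a v + h))) has_real_derivative D v a) (at 0)"
    and "\<And>v. v \<in> V \<Longrightarrow> ck_on n V S (D v)"
  shows "ck_on (Suc n) V S g"
proof -
  have "ck_on n V S (pdiff g v)" if "v \<in> V" for v
    by (rule ck_on_cong[OF assms(1) _ assms(4)[OF that]]) (simp add: pdiff_eqI[OF assms(3)[OF that]])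
  then show ?thesis using assms by (auto simp: field_differentiable_def)
qed

section \<open>Closure of the classes \<open>C^n\<close> under algebraic operations\<close>

lemma ck_on_const:
  assumes "opn V S" shows "ck_on n V S (\<lambda>_. c)"
proof (induction n arbitrary: c)
  case 0
  then show ?case by (auto intro: cont_onI)
next
  case (Suc n)
  show ?case by (rule ck_on_SucI[OF assms _ _ Suc.IH[of 0]]) (auto intro: cont_onI)
qed

lemma ck_on_coord:
  assumes "opn V S" "v \<in> V" shows "ck_on n V S (\<lambda>a. a v)"
proof (cases n)
  case 0
  then show ?thesis using assms(2) by (auto intro!: cont_onI tendsto_nbh_coord)
next
  case (Suc k)
  show ?thesis unfolding Suc
  proof (rule ck_on_SucI[OF assms(1), where D = "\<lambda>w a. if w = v then 1 else 0"])
    show "cont_on V S (\<lambda>a. a v)" using assms(2) by (auto intro!: cont_onI tendsto_nbh_coord)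
    show "((\<lambda>h. (a(w := a w + h)) v) has_real_derivative (if w = v then 1 else 0)) (at 0)"
      for w and a :: "'a \<Rightarrow> real" by (auto intro!: derivative_eq_intros)
  qed (rule ck_on_const[OF assms(1)])
qed

lemma ck_on_add:
  assumes "opn V S" "ck_on n V S f" "ck_on n V S g"
  shows "ck_on n V S (\<lambda>a. f a + g a)"
  using assms(2,3)
proof (induction n arbitrary: f g)
  case 0
  then show ?case by (auto intro!: cont_onI tendsto_add dest: cont_onD)
next
  case (Suc n)
  show ?case
  proof (rule ck_on_SucI[OF assms(1), where D = "\<lambda>v a. pdiff f v a + pdiff g v a"])
    show "cont_on V S (\<lambda>a. f a + g a)"
      using Suc.prems[THEN ck_on_cont] by (auto intro!: cont_onI tendsto_add dest: cont_onD)
    show "((\<lambda>h. f (a(v := a v + h)) + g (a(v := a v + h))) has_real_derivative pdiff f v a + pdiff g v a) (at 0)"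
      if "v \<in> V" "a \<in> S" for v a
      by (intro DERIV_add ck_on_pderiv[OF Suc.prems(1) that] ck_on_pderiv[OF Suc.prems(2) that])
    show "ck_on n V S (\<lambda>a. pdiff f v a + pdiff g v a)" if "v \<in> V" for v
      by (intro Suc.IH ck_on_pdiff[OF Suc.prems(1) that] ck_on_pdiff[OF Suc.prems(2) that])
  qed
qed

text \<open>By the product rule a partial derivative is a sum of products of one differentiated and
  one original factor. The original factors are lowered to order \<open>n\<close> by
  \<open>ck_on_Suc_imp\<close> before the induction hypothesis applies.\<close>

lemma ck_on_mult:
  assumes "opn V S" "ck_on n V S f" "ck_on n V S g"
  shows "ck_on n V S (\<lambda>a. f a * g a)"
  using assms(2,3)
proof (induction n arbitrary: f g)
  case 0
  then show ?case by (auto intro!: cont_onI tendsto_mult dest: cont_onD)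
next
  case (Suc n)
  show ?case
  proof (rule ck_on_SucI[OF assms(1), where D = "\<lambda>v a. pdiff f v a * g a + f a * pdiff g v a"])
    show "cont_on V S (\<lambda>a. f a * g a)"
      using Suc.prems[THEN ck_on_cont] by (auto intro!: cont_onI tendsto_mult dest: cont_onD)
    show "((\<lambda>h. f (a(v := a v + h)) * g (a(v := a v + h))) has_real_derivative
        pdiff f v a * g a + f a * pdiff g v a) (at 0)" if "v \<in> V" "a \<in> S" for v a
      by (rule DERIV_cong[OF DERIV_mult[OF ck_on_pderiv[OF Suc.prems(1) that] ck_on_pderiv[OF Suc.prems(2) that]]])
         (simp add: mult.commute)
    show "ck_on n V S (\<lambda>a. pdiff f v a * g a + f a * pdiff g v a)" if "v \<in> V" for v
      by (intro Suc.IH ck_on_add[OF assms(1)] ck_on_pdiff[OF Suc.prems(1) that] ck_on_pdiff[OF Suc.prems(2) that]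
          ck_on_Suc_imp[OF Suc.prems(1)] ck_on_Suc_imp[OF Suc.prems(2)])
  qed
qed

lemma ck_on_sum:
  assumes "opn V S" "\<And>i. i \<in> I \<Longrightarrow> ck_on n V S (f i)"
  shows "ck_on n V S (\<lambda>a. \<Sum>i\<in>I. f i a)"
  using assms(2)
  by (induction I rule: infinite_finite_induct) (simp_all add: ck_on_const assms(1) ck_on_add)

lemma ck_on_prod:
  assumes "opn V S" "\<And>i. i \<in> I \<Longrightarrow> ck_on n V S (f i)"
  shows "ck_on n V S (\<lambda>a. \<Prod>i\<in>I. f i a)"
  using assms(2)
  by (induction I rule: infinite_finite_induct) (simp_all add: ck_on_const assms(1) ck_on_mult)

text \<open>The derivative of \<open>1/f\<close> is built from \<open>1/f\<close> and a derivative
  of \<open>f\<close>, so the induction hypothesis for the same \<open>f\<close> at the lower order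
  suffices.\<close>

lemma ck_on_inverse:
  assumes "opn V S" "ck_on n V S f" "\<And>a. a \<in> S \<Longrightarrow> f a \<noteq> 0"
  shows "ck_on n V S (\<lambda>a. inverse (f a))"
  using assms(2)
proof (induction n)
  case 0
  then show ?case using assms(3) by (auto intro!: cont_onI tendsto_inverse dest: cont_onD)
next
  case (Suc n)
  show ?case
  proof (rule ck_on_SucI[OF assms(1), where D = "\<lambda>v a. (-1) * (inverse (f a) * pdiff f v a * inverse (f a))"])
    show "cont_on V S (\<lambda>a. inverse (f a))"
      using Suc.prems[THEN ck_on_cont] assms(3) by (auto intro!: cont_onI tendsto_inverse dest: cont_onD)
    show "((\<lambda>h. inverse (f (a(v := a v + h)))) has_real_derivative
        (-1) * (inverse (f a) * pdiff f v a * inverse (f a))) (at 0)" if "v \<in> V" "a \<in> S" for v a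
      by (rule DERIV_cong[OF DERIV_inverse'[OF ck_on_pderiv[OF Suc.prems(1) that]]])
         (simp_all add: assms(3)[OF that(2)])
    show "ck_on n V S (\<lambda>a. (-1) * (inverse (f a) * pdiff f v a * inverse (f a)))" if "v \<in> V" for v
      by (intro Suc.IH ck_on_mult ck_on_const assms(1) ck_on_pdiff[OF Suc.prems(1) that] ck_on_Suc_imp[OF Suc.prems(1)])
  qed
qed

section \<open>Mean value estimate and chain rule\<close>

text \<open>Turns a partial derivative at the point \<open>a(v := x)\<close> into the derivative at
  \<open>x\<close> of a function of one variable, which is what the one-dimensional mean value
  estimate takes.\<close>

lemma line_deriv:
  assumes "((\<lambda>h. g ((a(v := x))(v := (a(v := x)) v + h))) has_real_derivative D) (at 0)"
  shows "((\<lambda>s. g (a(v := s))) has_real_derivative D) (at x)"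
proof -
  have "((\<lambda>h. g (a(v := x + h))) has_real_derivative D) (at 0)"
    using assms by (simp only: fun_upd_upd fun_upd_same)
  then show ?thesis using DERIV_shift[of "\<lambda>s. g (a(v := s))" D 0 x] by (simp add: add.commute)
qed

text \<open>Moving from \<open>a\<close> to \<open>b\<close> one coordinate at a time stays in the box.\<close>

lemma box_mean_value:
  assumes "finite V" "a \<in> bx V p e" "b \<in> bx V p e"
    and der: "\<And>v z. v \<in> V \<Longrightarrow> z \<in> bx V p e \<Longrightarrow>
      ((\<lambda>h. g (z(v := z v + h))) has_real_derivative D v z) (at 0)"
    and bd: "\<And>v z. v \<in> V \<Longrightarrow> z \<in> bx V p e \<Longrightarrow> \<bar>D v z\<bar> \<le> M"
  shows "\<bar>g b - g a\<bar> \<le> M * (\<Sum>v\<in>V. \<bar>b v - a v\<bar>)"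
proof -
  \<comment> \<open>\<open>A\<close> collects the coordinates in which the two points may still
    differ. The starting point varies in the induction, the end point stays.\<close>
  have main: "\<bar>g b - g a\<bar> \<le> M * (\<Sum>v\<in>A. \<bar>b v - a v\<bar>)"
    if "finite A" "A \<subseteq> V" "a \<in> bx V p e" "b \<in> bx V p e" "\<And>v. v \<notin> A \<Longrightarrow> a v = b v" for A a b
    using that
  proof (induction A arbitrary: a rule: finite_induct)
    case empty
    then have "a = b" by auto
    then show ?case by simp
  next
    case (insert x A)
    define c where "c = a(x := b x)"
    have xV: "x \<in> V" using insert.prems by simp
    \<comment> \<open>An interval is convex, so the box is not left while the single coordinate
      \<open>x\<close> moves from \<open>a x\<close> to \<open>b x\<close>.\<close>
    have seg: "a(x := s) \<in> bx V p e" if "s \<in> closed_segment (a x) (b x)" for s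
    proof -
      have "s \<in> ball (p x) e"
        using insert.prems(2,3) xV that closed_segment_subset[of "a x" "ball (p x) e" "b x"]
        by (auto simp: bx_def dist_real_def abs_minus_commute)
      then show ?thesis
        using insert.prems(2) upd_in_pts[of a V x] xV by (auto simp: bx_def dist_real_def abs_minus_commute)
    qed
    have cbx: "c \<in> bx V p e" unfolding c_def by (rule seg) simp
    have "\<bar>g b - g c\<bar> \<le> M * (\<Sum>v\<in>A. \<bar>b v - c v\<bar>)"
    proof (rule insert.IH)
      show "c v = b v" if "v \<notin> A" for v using insert.prems(4)[of v] that by (auto simp: c_def)
    qed (use insert.prems cbx in simp_all)
    also have "(\<Sum>v\<in>A. \<bar>b v - c v\<bar>) = (\<Sum>v\<in>A. \<bar>b v - a v\<bar>)"
      by (rule sum.cong) (use insert.hyps in \<open>auto simp: c_def\<close>)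
    finally have 1: "\<bar>g b - g c\<bar> \<le> M * (\<Sum>v\<in>A. \<bar>b v - a v\<bar>)" .
    have "norm (g (a(x := b x)) - g (a(x := a x))) \<le> M * norm (b x - a x)"
    proof (rule field_differentiable_bound[where S = "closed_segment (a x) (b x)"
          and f = "\<lambda>s. g (a(x := s))" and f' = "\<lambda>s. D x (a(x := s))"])
      fix s assume "s \<in> closed_segment (a x) (b x)"
      then have s: "a(x := s) \<in> bx V p e" by (rule seg)
      show "norm (D x (a(x := s))) \<le> M" using bd[OF xV s] by simp
      show "((\<lambda>s. g (a(x := s))) has_field_derivative D x (a(x := s))) (at s within closed_segment (a x) (b x))"
        using line_deriv[OF der[OF xV s]] by (rule DERIV_subset) simp
    qed auto
    then have 2: "\<bar>g c - g a\<bar> \<le> M * \<bar>b x - a x\<bar>" by (simp add: c_def)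
    show ?case using 1 2 insert.hyps by (simp add: distrib_left)
  qed
  show ?thesis
    by (rule main) (use assms in \<open>auto simp: bx_def pts_def\<close>)
qed

text \<open>Continuity of the partial derivatives yields total differentiability: after the linear
  part at \<open>a\<close> is subtracted, the partial derivatives are below \<open>e\<close> in a
  small box, and \<open>box_mean_value\<close> applies to the difference.\<close>

lemma ck1_frechet:
  assumes V: "finite V" and S: "opn V S" and g: "ck_on (Suc 0) V S g" and a: "a \<in> S" and e: "e > 0"
  shows "eventually (\<lambda>b. \<bar>g b - g a - (\<Sum>v\<in>V. pdiff g v a * (b v - a v))\<bar> \<le> e * (\<Sum>v\<in>V. \<bar>b v - a v\<bar>))
           (nbh V S a)"
proof -
  have "\<forall>v\<in>V. eventually (\<lambda>b. \<bar>pdiff g v b - pdiff g v a\<bar> < e) (nbh V S a)"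
  proof
    fix v assume "v \<in> V"
    then have "(pdiff g v \<longlongrightarrow> pdiff g v a) (nbh V S a)"
      using cont_onD[OF ck_on_cont[OF ck_on_pdiff[OF g]] a] by blast
    then show "eventually (\<lambda>b. \<bar>pdiff g v b - pdiff g v a\<bar> < e) (nbh V S a)"
      using e unfolding tendsto_iff dist_real_def by blast
  qed
  then have "eventually (\<lambda>b. \<forall>v\<in>V. \<bar>pdiff g v b - pdiff g v a\<bar> < e) (nbh V S a)"
    by (rule eventually_ball_finite[OF V])
  with eventually_nbh_self
  have "eventually (\<lambda>b. b \<in> S \<and> (\<forall>v\<in>V. \<bar>pdiff g v b - pdiff g v a\<bar> < e)) (nbh V (pts V) a)"
    unfolding nbh_opn[OF S a, symmetric] by eventually_elim simp
  then obtain d where d: "d > 0" "\<And>b. b \<in> bx V a d \<Longrightarrow> b \<in> S"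
    "\<And>b v. b \<in> bx V a d \<Longrightarrow> v \<in> V \<Longrightarrow> \<bar>pdiff g v b - pdiff g v a\<bar> < e"
    unfolding eventually_nbh bx_def by blast
  have apts: "a \<in> pts V" using opn_ptsD[OF S a] .
  have "\<bar>g b - g a - (\<Sum>v\<in>V. pdiff g v a * (b v - a v))\<bar> \<le> e * (\<Sum>v\<in>V. \<bar>b v - a v\<bar>)"
    if b: "b \<in> bx V a d" for b
  proof -
    define k where "k = (\<lambda>z. g z - (\<Sum>v\<in>V. pdiff g v a * z v))"
    have "\<bar>k b - k a\<bar> \<le> e * (\<Sum>v\<in>V. \<bar>b v - a v\<bar>)"
    proof (rule box_mean_value[OF V bx_self[OF apts d(1)] b, where D = "\<lambda>v z. pdiff g v z - pdiff g v a"])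
      fix v z assume v: "v \<in> V" and z: "z \<in> bx V a d"
      have "((\<lambda>h. (z(v := z v + h)) w) has_real_derivative (if w = v then 1 else 0)) (at 0)" for w
        by (auto intro!: derivative_eq_intros)
      then have "((\<lambda>h. \<Sum>w\<in>V. pdiff g w a * (z(v := z v + h)) w) has_real_derivative
          (\<Sum>w\<in>V. pdiff g w a * (if w = v then 1 else 0))) (at 0)"
        by (intro DERIV_sum DERIV_cmult)
      then have "((\<lambda>h. \<Sum>w\<in>V. pdiff g w a * (z(v := z v + h)) w) has_real_derivative pdiff g v a) (at 0)"
        by (rule DERIV_cong) (simp add: mult_delta_right v V)
      then show "((\<lambda>h. k (z(v := z v + h))) has_real_derivative pdiff g v z - pdiff g v a) (at 0)"
        unfolding k_def by (rule DERIV_diff[OF ck_on_pderiv[OF g v d(2)[OF z]]])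
      show "\<bar>pdiff g v z - pdiff g v a\<bar> \<le> e" using d(3)[OF z v] by simp
    qed
    also have "k b - k a = g b - g a - (\<Sum>v\<in>V. pdiff g v a * (b v - a v))"
      by (simp add: k_def right_diff_distrib sum_subtractf)
    finally show ?thesis .
  qed
  then show ?thesis
    unfolding nbh_opn[OF S a] eventually_nbh using d(1) by (auto simp: bx_def)
qed

text \<open>The quotient has the junk value \<open>0\<close> at \<open>b = a\<close>, where the remainder vanishes as well.\<close>

lemma ck1_remainder:
  assumes V: "finite V" and S: "opn V S" and g: "ck_on (Suc 0) V S g" and a: "a \<in> S"
  shows "((\<lambda>b. (g b - g a - (\<Sum>v\<in>V. pdiff g v a * (b v - a v))) / (\<Sum>v\<in>V. \<bar>b v - a v\<bar>)) \<longlongrightarrow> 0) (nbh V S a)"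
  unfolding tendsto_iff
proof (intro allI impI)
  fix e :: real assume e: "e > 0"
  have "eventually (\<lambda>b. \<bar>g b - g a - (\<Sum>v\<in>V. pdiff g v a * (b v - a v))\<bar> \<le> e/2 * (\<Sum>v\<in>V. \<bar>b v - a v\<bar>))
           (nbh V S a)"
    by (rule ck1_frechet[OF assms]) (use e in simp)
  then show "eventually (\<lambda>b. dist ((g b - g a - (\<Sum>v\<in>V. pdiff g v a * (b v - a v))) / (\<Sum>v\<in>V. \<bar>b v - a v\<bar>)) 0 < e) (nbh V S a)"
  proof eventually_elim
    case (elim b)
    have nn: "0 \<le> (\<Sum>v\<in>V. \<bar>b v - a v\<bar>)" by (simp add: sum_nonneg)
    show ?case
    proof (cases "(\<Sum>v\<in>V. \<bar>b v - a v\<bar>) = 0")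
      case False
      then have "(\<Sum>v\<in>V. \<bar>b v - a v\<bar>) > 0" using nn by linarith
      then have "\<bar>(g b - g a - (\<Sum>v\<in>V. pdiff g v a * (b v - a v))) / (\<Sum>v\<in>V. \<bar>b v - a v\<bar>)\<bar> \<le> e / 2"
        using elim by (simp add: abs_divide divide_le_eq)
      then show ?thesis using e unfolding dist_real_def by linarith
    qed (use e in simp)
  qed
qed

text \<open>The quotient of \<open>ck1_remainder\<close> serves as \<open>\<theta>\<close>. Where
  its denominator vanishes, \<open>b = a\<close>, because points of \<open>S\<close> are zero
  outside \<open>V\<close>, and both sides are zero.\<close>

lemma remainder_split:
  assumes V: "finite V" and S: "opn V S" and g: "ck_on (Suc 0) V S g" and a: "a \<in> S"
  obtains \<theta> where "(\<theta> \<longlongrightarrow> 0) (nbh V S a)"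
    "\<forall>b\<in>S. g b - g a = (\<Sum>v\<in>V. pdiff g v a * (b v - a v)) + \<theta> b * (\<Sum>v\<in>V. \<bar>b v - a v\<bar>)"
proof (rule that[OF ck1_remainder[OF assms]], rule ballI)
  fix b assume b: "b \<in> S"
  show "g b - g a = (\<Sum>v\<in>V. pdiff g v a * (b v - a v)) +
     (g b - g a - (\<Sum>v\<in>V. pdiff g v a * (b v - a v))) / (\<Sum>v\<in>V. \<bar>b v - a v\<bar>) * (\<Sum>v\<in>V. \<bar>b v - a v\<bar>)"
  proof (cases "(\<Sum>v\<in>V. \<bar>b v - a v\<bar>) = 0")
    case True
    then have "\<forall>v\<in>V. b v = a v" by (simp add: sum_nonneg_eq_0_iff V)
    moreover have "b \<in> pts V" "a \<in> pts V" using b a opn_ptsD[OF S] by auto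
    ultimately have "b = a" by (auto simp: pts_def fun_eq_iff)
    then show ?thesis by simp
  qed auto
qed

text \<open>The first-order expansion of \<open>g\<close> at \<open>c t\<close> is divided by
  \<open>s - t\<close>. The slopes of the coordinates converge, so the remainder, a convergent sum
  times factors that tend to 0, disappears.\<close>

lemma chain_rule:
  assumes V: "finite V" and S: "opn V S" and g: "ck_on (Suc 0) V S g" and ct: "c t \<in> S"
    and ev: "eventually (\<lambda>s. c s \<in> S) (at t)"
    and c: "\<And>v. v \<in> V \<Longrightarrow> ((\<lambda>s. c s v) has_real_derivative c' v) (at t)"
  shows "((\<lambda>s. g (c s)) has_real_derivative (\<Sum>v\<in>V. pdiff g v (c t) * c' v)) (at t)"
proof -
  obtain \<theta> where \<theta>: "(\<theta> \<longlongrightarrow> 0) (nbh V S (c t))"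
    "\<forall>b\<in>S. g b - g (c t) = (\<Sum>v\<in>V. pdiff g v (c t) * (b v - c t v)) + \<theta> b * (\<Sum>v\<in>V. \<bar>b v - c t v\<bar>)"
    by (rule remainder_split[OF V S g ct])
  have flim: "filterlim c (nbh V S (c t)) (at t)"
    by (rule filterlim_nbh[OF V ev]) (use c DERIV_isCont in \<open>auto simp: isCont_def\<close>)
  have q: "((\<lambda>s. (c s v - c t v) / (s - t)) \<longlongrightarrow> c' v) (at t)" if "v \<in> V" for v
    using c[OF that] by (simp add: has_field_derivative_iff)
  have sl: "((\<lambda>s. \<bar>(c s v - c t v) / \<bar>s - t\<bar>\<bar>) \<longlongrightarrow> \<bar>c' v\<bar>) (at t)" if "v \<in> V" for v
    using tendsto_rabs[OF q[OF that]] by (simp add: abs_divide)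
  \<comment> \<open>The size of the increment over \<open>s - t\<close> is a sign times a sum of
    absolute slopes. The sign has no limit at \<open>t\<close>, but it is bounded and is multiplied
    by \<open>\<theta> (c s)\<close>, which tends to 0.\<close>
  have lim: "((\<lambda>s. (\<Sum>v\<in>V. pdiff g v (c t) * ((c s v - c t v) / (s - t))) +
        \<theta> (c s) * sgn (s - t) * (\<Sum>v\<in>V. \<bar>(c s v - c t v) / \<bar>s - t\<bar>\<bar>)) \<longlongrightarrow>
      (\<Sum>v\<in>V. pdiff g v (c t) * c' v) + 0 * (\<Sum>v\<in>V. \<bar>c' v\<bar>)) (at t)"
  proof (intro tendsto_add tendsto_sum tendsto_mult q sl tendsto_const)
    have "((\<lambda>s. \<theta> (c s)) \<longlongrightarrow> 0) (at t)" using filterlim_compose[OF \<theta>(1) flim] .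
    then show "((\<lambda>s. \<theta> (c s) * sgn (s - t)) \<longlongrightarrow> 0) (at t)"
      by (rule Lim_null_comparison[rotated, OF tendsto_norm_zero])
         (auto intro!: always_eventually simp: abs_mult sgn_if)
  qed
  have "((\<lambda>s. (g (c s) - g (c t)) / (s - t)) \<longlongrightarrow> (\<Sum>v\<in>V. pdiff g v (c t) * c' v)) (at t)"
  proof (rule Lim_transform_eventually[OF lim[unfolded mult_zero_left add_0_right]])
    have "eventually (\<lambda>s. s \<noteq> t) (at t)" by (simp add: eventually_at_filter)
    with ev show "eventually (\<lambda>s. (\<Sum>v\<in>V. pdiff g v (c t) * ((c s v - c t v) / (s - t))) +
        \<theta> (c s) * sgn (s - t) * (\<Sum>v\<in>V. \<bar>(c s v - c t v) / \<bar>s - t\<bar>\<bar>) = (g (c s) - g (c t)) / (s - t)) (at t)"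
    proof eventually_elim
      case (elim s)
      have 1: "(\<Sum>v\<in>V. pdiff g v (c t) * ((c s v - c t v) / (s - t))) =
          (\<Sum>v\<in>V. pdiff g v (c t) * (c s v - c t v)) / (s - t)"
        by (simp add: sum_divide_distrib)
      have 2: "sgn (s - t) * (\<Sum>v\<in>V. \<bar>(c s v - c t v) / \<bar>s - t\<bar>\<bar>) = (\<Sum>v\<in>V. \<bar>c s v - c t v\<bar>) / (s - t)"
      proof -
        have "(\<Sum>v\<in>V. \<bar>(c s v - c t v) / \<bar>s - t\<bar>\<bar>) = (\<Sum>v\<in>V. \<bar>c s v - c t v\<bar>) / \<bar>s - t\<bar>"
          by (simp add: sum_divide_distrib abs_divide)
        moreover have "sgn (s - t) / \<bar>s - t\<bar> = 1 / (s - t)"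
          using elim(2) by (simp add: sgn_if abs_if divide_simps)
        ultimately show ?thesis by (metis times_divide_eq_left times_divide_eq_right mult.commute mult_1)
      qed
      show ?case
        using bspec[OF \<theta>(2) elim(1)] unfolding 1 mult.assoc 2 by (simp add: add_divide_distrib)
    qed
  qed
  then show ?thesis by (simp add: has_field_derivative_iff)
qed

section \<open>Composition of \<open>C^n\<close> maps\<close>

lemma cont_on_compose:
  assumes "finite V" "cont_on V X f" "\<And>w. w \<in> W \<Longrightarrow> G w \<in> X" "\<And>v. v \<in> V \<Longrightarrow> cont_on J W (\<lambda>w. G w v)"
  shows "cont_on J W (\<lambda>w. f (G w))"
proof (rule cont_onI)
  fix w assume w: "w \<in> W"
  have "filterlim G (nbh V X (G w)) (nbh J W w)"
  proof (rule filterlim_nbh[OF assms(1)])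
    show "eventually (\<lambda>s. G s \<in> X) (nbh J W w)"
      using eventually_nbh_self by eventually_elim (rule assms(3))
  qed (use cont_onD[OF assms(4) w] in blast)
  then show "((\<lambda>w. f (G w)) \<longlongrightarrow> f (G w)) (nbh J W w)"
    by (rule filterlim_compose[OF cont_onD[OF assms(2) assms(3)[OF w]]])
qed

text \<open>By the chain rule a partial derivative is a sum of products of \<open>pdiff f v\<close>
  after \<open>G\<close> with derivatives of the components of \<open>G\<close>. The induction
  therefore generalises over \<open>f\<close> and keeps \<open>G\<close>.\<close>

lemma ck_on_compose:
  assumes V: "finite V" and X: "opn V X" and W: "opn J W" and f: "ck_on n V X f"
    and G: "\<And>w. w \<in> W \<Longrightarrow> G w \<in> X" and ck: "\<And>v. v \<in> V \<Longrightarrow> ck_on n J W (\<lambda>w. G w v)"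
  shows "ck_on n J W (\<lambda>w. f (G w))"
  using f ck
proof (induction n arbitrary: f)
  case 0
  show ?case unfolding ck_on.simps
    by (rule cont_on_compose[OF V _ G]) (use 0 in simp_all)
next
  case (Suc n)
  show ?case
  proof (rule ck_on_SucI[OF W, where D = "\<lambda>j w. \<Sum>v\<in>V. pdiff f v (G w) * pdiff (\<lambda>w. G w v) j w"])
    show "cont_on J W (\<lambda>w. f (G w))"
      by (rule cont_on_compose[OF V ck_on_cont[OF Suc.prems(1)] G ck_on_cont[OF Suc.prems(2)]])
    show "((\<lambda>h. f (G (w(j := w j + h)))) has_real_derivative
        (\<Sum>v\<in>V. pdiff f v (G w) * pdiff (\<lambda>w. G w v) j w)) (at 0)" if j: "j \<in> J" and w: "w \<in> W" for j w
    proof -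
      have "ck_on (Suc 0) V X f"
        using ck_on_cont[OF Suc.prems(1)] Suc.prems(1) ck_on_cont[OF ck_on_pdiff[OF Suc.prems(1)]] by simp
      moreover have "eventually (\<lambda>h. G (w(j := w j + h)) \<in> X) (at 0)"
        using eventually_upd[OF W w j] unfolding eventually_at_filter by eventually_elim (blast intro: G)
      ultimately show ?thesis
        using chain_rule[OF V X, of f "\<lambda>h. G (w(j := w j + h))" 0 "\<lambda>v. pdiff (\<lambda>w. G w v) j w"]
          ck_on_pderiv[OF Suc.prems(2) j w] G[OF w] by simp
    qed
    show "ck_on n J W (\<lambda>w. \<Sum>v\<in>V. pdiff f v (G w) * pdiff (\<lambda>w. G w v) j w)" if j: "j \<in> J" for j
    proof (intro ck_on_sum[OF W] ck_on_mult[OF W])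
      fix v assume v: "v \<in> V"
      show "ck_on n J W (\<lambda>w. pdiff f v (G w))"
        by (rule Suc.IH[OF ck_on_pdiff[OF Suc.prems(1) v] ck_on_Suc_imp[OF Suc.prems(2)]])
      show "ck_on n J W (pdiff (\<lambda>w. G w v) j)" by (rule ck_on_pdiff[OF Suc.prems(2)[OF v] j])
    qed
  qed
qed

section \<open>Smooth matrix inverses\<close>

text \<open>Links the determinants of the regularity assumption to homogeneous linear systems. In
  that form block triangular matrices are handled by substitution, and indices may be coordinate
  names.\<close>

lemma det_nonzero_iff_trivial_kernel:
  fixes A :: "nat \<Rightarrow> nat \<Rightarrow> real"
  shows "det (mat n n (\<lambda>(k, l). A k l)) \<noteq> 0 \<longleftrightarrow>
    (\<forall>x. (\<forall>k<n. (\<Sum>l<n. A k l * x l) = 0) \<longrightarrow> (\<forall>l<n. x l = 0))"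
    (is "det ?M \<noteq> 0 \<longleftrightarrow> ?R")
proof -
  have prod: "(?M *\<^sub>v v) $ k = (\<Sum>l<n. A k l * v $ l)" if "v \<in> carrier_vec n" "k < n" for v k
    using that by (auto simp: mult_mat_vec_def scalar_prod_def atLeast0LessThan intro!: sum.cong)
  have "det ?M = 0 \<longleftrightarrow> (\<exists>v. v \<in> carrier_vec n \<and> v \<noteq> 0\<^sub>v n \<and> ?M *\<^sub>v v = 0\<^sub>v n)"
    by (rule det_0_iff_vec_prod_zero_field) simp
  also have "\<dots> \<longleftrightarrow> \<not> ?R"
  proof
    assume "\<exists>v. v \<in> carrier_vec n \<and> v \<noteq> 0\<^sub>v n \<and> ?M *\<^sub>v v = 0\<^sub>v n"
    then obtain v where v: "v \<in> carrier_vec n" "v \<noteq> 0\<^sub>v n" "?M *\<^sub>v v = 0\<^sub>v n" by blast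
    have "(\<Sum>l<n. A k l * v $ l) = 0" if "k < n" for k
      using prod[OF v(1) that] v(3) that by simp
    moreover have "\<exists>l<n. v $ l \<noteq> 0"
    proof (rule ccontr)
      assume "\<not> ?thesis"
      then have "v = 0\<^sub>v n" using v(1) by (intro eq_vecI) auto
      with v(2) show False by simp
    qed
    ultimately show "\<not> ?R" by blast
  next
    assume "\<not> ?R"
    then obtain x l where x: "\<forall>k<n. (\<Sum>l<n. A k l * x l) = 0" "l < n" "x l \<noteq> 0" by blast
    have "vec n x \<in> carrier_vec n" by simp
    moreover have "vec n x \<noteq> 0\<^sub>v n"
      using x(2,3) by (metis index_vec index_zero_vec(1))
    moreover have "?M *\<^sub>v vec n x = 0\<^sub>v n"
    proof (rule eq_vecI)
      fix k assume "k < dim_vec (0\<^sub>v n :: real vec)"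
      then have k: "k < n" by simp
      have "(?M *\<^sub>v vec n x) $ k = (\<Sum>l<n. A k l * vec n x $ l)" by (rule prod) (use k in auto)
      also have "\<dots> = 0" using x(1) k by simp
      finally show "(?M *\<^sub>v vec n x) $ k = 0\<^sub>v n $ k" using k by simp
    qed simp
    ultimately show "\<exists>v. v \<in> carrier_vec n \<and> v \<noteq> 0\<^sub>v n \<and> ?M *\<^sub>v v = 0\<^sub>v n" by blast
  qed
  finally show ?thesis by blast
qed

lemma smooth_onD: "smooth_on V S g \<Longrightarrow> ck_on n V S g"
  by (simp add: smooth_on_def)

text \<open>The Leibniz expansion is a polynomial in the entries.\<close>

lemma smooth_on_det:
  assumes S: "opn V S" and A: "\<And>k l. k < n \<Longrightarrow> l < n \<Longrightarrow> smooth_on V S (\<lambda>a. A a k l)"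
  shows "smooth_on V S (\<lambda>a. det (mat n n (\<lambda>(k, l). A a k l)))"
  unfolding smooth_on_def
proof
  fix q
  have "ck_on q V S (\<lambda>a. \<Sum>\<pi> \<in> {\<pi>. \<pi> permutes {0..<n}}. signof \<pi> * (\<Prod>i = 0..<n. A a i (\<pi> i)))"
    by (intro ck_on_sum ck_on_mult ck_on_prod ck_on_const S smooth_onD A)
       (auto dest: permutes_in_image)
  moreover have "det (mat n n (\<lambda>(k, l). A a k l)) =
     (\<Sum>\<pi> \<in> {\<pi>. \<pi> permutes {0..<n}}. signof \<pi> * (\<Prod>i = 0..<n. A a i (\<pi> i)))" for a
    by (subst det_def'[of _ n]) (auto intro!: sum.cong prod.cong dest: permutes_in_image)
  ultimately show "ck_on q V S (\<lambda>a. det (mat n n (\<lambda>(k, l). A a k l)))" by simp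
qed

text \<open>Up to sign an entry of the adjugate is a minor, hence again a determinant formed from
  the entries \<open>A\<close>.\<close>

lemma smooth_on_adj_mat:
  assumes S: "opn V S" and A: "\<And>k l. k < n \<Longrightarrow> l < n \<Longrightarrow> smooth_on V S (\<lambda>a. A a k l)"
    and kl: "k < n" "l < n"
  shows "smooth_on V S (\<lambda>a. adj_mat (mat n n (\<lambda>(k, l). A a k l)) $$ (k, l))"
proof -
  \<comment> \<open>\<open>d i\<close> enumerates the indices other than \<open>i\<close>: index
    \<open>k\<close> of a minor is index \<open>d i k\<close> of the full matrix.\<close>
  define d where "d i k = (if k < i then k else Suc k)" for i k :: nat
  have "adj_mat (mat n n (\<lambda>(k, l). A a k l)) $$ (k, l) =
     (-1) ^ (l + k) * det (mat (n - 1) (n - 1) (\<lambda>(i, j). A a (d l i) (d k j)))" for a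
  proof -
    have "mat_delete (mat n n (\<lambda>(k, l). A a k l)) l k = mat (n - 1) (n - 1) (\<lambda>(i, j). A a (d l i) (d k j))"
      by (rule eq_matI) (auto simp: mat_delete_def d_def)
    then show ?thesis using kl by (simp add: adj_mat_def cofactor_def)
  qed
  moreover have "smooth_on V S (\<lambda>a. det (mat (n - 1) (n - 1) (\<lambda>(i, j). A a (d l i) (d k j))))"
    by (rule smooth_on_det[OF S]) (rule A; auto simp: d_def)
  then have "smooth_on V S (\<lambda>a. (-1) ^ (l + k) * det (mat (n - 1) (n - 1) (\<lambda>(i, j). A a (d l i) (d k j))))"
    unfolding smooth_on_def by (intro allI ck_on_mult ck_on_const S) blast
  ultimately show ?thesis by simp
qed

text \<open>Cramer's rule. Rows are named by \<open>J\<close> and columns by \<open>V\<close>;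
  enumerating both by \<open>{..<n}\<close> gives a square matrix. Its trivial kernel at
  \<open>p\<close> makes the determinant non-zero there, and \<open>X\<close> is the open set where
  it stays non-zero.\<close>

lemma smooth_matrix_inverse:
  fixes A :: "('v \<Rightarrow> real) \<Rightarrow> 'j \<Rightarrow> 'v \<Rightarrow> real"
  assumes V: "finite V" and J: "finite J" "card J = card V" and S: "opn V S" and p: "p \<in> S"
    and A: "\<And>j v. j \<in> J \<Longrightarrow> v \<in> V \<Longrightarrow> smooth_on V S (\<lambda>a. A a j v)"
    and ker: "\<And>\<xi>. (\<And>j. j \<in> J \<Longrightarrow> (\<Sum>v\<in>V. A p j v * \<xi> v) = 0) \<Longrightarrow> (\<And>v. v \<in> V \<Longrightarrow> \<xi> v = 0)"
  obtains X B where "opn V X" "p \<in> X" "X \<subseteq> S"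
    "\<And>v j. v \<in> V \<Longrightarrow> j \<in> J \<Longrightarrow> smooth_on V X (\<lambda>a. B a v j)"
    "\<And>a v v'. a \<in> X \<Longrightarrow> v \<in> V \<Longrightarrow> v' \<in> V \<Longrightarrow> (\<Sum>j\<in>J. B a v j * A a j v') = (if v = v' then 1 else 0)"
    "\<And>a j j'. a \<in> X \<Longrightarrow> j \<in> J \<Longrightarrow> j' \<in> J \<Longrightarrow> (\<Sum>v\<in>V. A a j v * B a v j') = (if j = j' then 1 else 0)"
proof -
  define n where "n = card V"
  obtain ev where ev: "bij_betw ev {..<n} V"
    using ex_bij_betw_nat_finite[OF V] unfolding n_def atLeast0LessThan by blast
  obtain ej where ej: "bij_betw ej {..<n} J"
    using ex_bij_betw_nat_finite[OF J(1)] unfolding n_def atLeast0LessThan J(2) by blast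
  define iv where "iv = inv_into {..<n} ev"
  define ij where "ij = inv_into {..<n} ej"
  have evV: "ev l \<in> V" if "l < n" for l using ev that by (auto simp: bij_betw_def)
  have ejJ: "ej l \<in> J" if "l < n" for l using ej that by (auto simp: bij_betw_def)
  have iv: "iv v < n" "ev (iv v) = v" if "v \<in> V" for v
    using that ev bij_betw_inv_into_right[OF ev that] inv_into_into[of v ev "{..<n}"]
    by (auto simp: iv_def bij_betw_def)
  have ij: "ij j < n" "ej (ij j) = j" if "j \<in> J" for j
    using that ej bij_betw_inv_into_right[OF ej that] inv_into_into[of j ej "{..<n}"]
    by (auto simp: ij_def bij_betw_def)
  have ivev: "iv (ev l) = l" if "l < n" for l
    using bij_betw_inv_into_left[OF ev] that by (simp add: iv_def)
  have ijej: "ij (ej l) = l" if "l < n" for l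
    using bij_betw_inv_into_left[OF ej] that by (simp add: ij_def)
  define M where "M a = mat n n (\<lambda>(k, l). A a (ej k) (ev l))" for a
  have Mc: "M a \<in> carrier_mat n n" for a by (simp add: M_def)
  have Mi: "M a $$ (k, l) = A a (ej k) (ev l)" if "k < n" "l < n" for a k l using that by (simp add: M_def)
  have detM: "smooth_on V S (\<lambda>a. det (M a))"
    unfolding M_def by (rule smooth_on_det[OF S]) (intro A evV ejJ)
  have adjM: "smooth_on V S (\<lambda>a. adj_mat (M a) $$ (k, l))" if "k < n" "l < n" for k l
    unfolding M_def by (rule smooth_on_adj_mat[OF S _ that]) (intro A evV ejJ)
  have "det (M p) \<noteq> 0"
    unfolding M_def det_nonzero_iff_trivial_kernel
  proof (intro allI impI)
    fix x :: "nat \<Rightarrow> real" and l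
    assume x: "\<forall>k<n. (\<Sum>l<n. A p (ej k) (ev l) * x l) = 0" and l: "l < n"
    have "x (iv (ev l)) = 0"
    proof (rule ker[of "\<lambda>v. x (iv v)"])
      fix j assume j: "j \<in> J"
      have "(\<Sum>v\<in>V. A p j v * x (iv v)) = (\<Sum>l<n. A p j (ev l) * x (iv (ev l)))"
        by (rule sum.reindex_bij_betw[OF ev, symmetric])
      also have "\<dots> = (\<Sum>l<n. A p (ej (ij j)) (ev l) * x l)"
        by (rule sum.cong) (simp_all add: ivev ij(2)[OF j])
      finally show "(\<Sum>v\<in>V. A p j v * x (iv v)) = 0" using x ij(1)[OF j] by simp
    qed (rule evV[OF l])
    then show "x l = 0" by (simp add: ivev l)
  qed
  \<comment> \<open>Non-vanishing is written as membership in the open set \<open>- {0}\<close> so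
    that \<open>opn_preimage\<close> applies.\<close>
  define X where "X = {a\<in>S. det (M a) \<in> - {0}}"
  define B where "B a v j = inverse (det (M a)) * adj_mat (M a) $$ (iv v, ij j)" for a v j
  have X: "opn V X" unfolding X_def
    by (rule opn_preimage[OF S]) (use ck_on_cont[OF smooth_onD[OF detM]] in auto)
  have XS: "X \<subseteq> S" by (auto simp: X_def)
  show thesis
  proof (rule that[OF X _ XS, of B])
    show "p \<in> X" using p \<open>det (M p) \<noteq> 0\<close> by (simp add: X_def)
    show "smooth_on V X (\<lambda>a. B a v j)" if "v \<in> V" "j \<in> J" for v j
      unfolding smooth_on_def B_def
      by (intro allI ck_on_mult[OF X] ck_on_inverse[OF X] ck_on_subset[OF _ XS]
          smooth_onD[OF detM] smooth_onD[OF adjM] iv ij that) (auto simp: X_def)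
    fix a assume a: "a \<in> X"
    then have d0: "det (M a) \<noteq> 0" by (simp add: X_def)
    note adj = adj_mat[OF Mc[of a]]
    show "(\<Sum>j\<in>J. B a v j * A a j v') = (if v = v' then 1 else 0)" if v: "v \<in> V" "v' \<in> V" for v v'
    proof -
      have "(\<Sum>j\<in>J. B a v j * A a j v') = (\<Sum>k<n. B a v (ej k) * A a (ej k) v')"
        by (rule sum.reindex_bij_betw[OF ej, symmetric])
      also have "\<dots> = (\<Sum>k<n. inverse (det (M a)) * (adj_mat (M a) $$ (iv v, k) * M a $$ (k, iv v')))"
        by (rule sum.cong) (simp_all add: B_def ijej Mi iv v)
      also have "\<dots> = inverse (det (M a)) * ((adj_mat (M a) * M a) $$ (iv v, iv v'))"
        using iv(1)[OF v(1)] iv(1)[OF v(2)] adj(1) Mc[of a]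
        by (auto simp: times_mat_def scalar_prod_def atLeast0LessThan sum_distrib_left intro!: sum.cong)
      also have "\<dots> = (if iv v = iv v' then 1 else 0)"
        unfolding adj(3) using iv(1)[OF v(1)] iv(1)[OF v(2)] d0 by simp
      also have "(iv v = iv v') = (v = v')" using iv(2) v by metis
      finally show ?thesis .
    qed
    show "(\<Sum>v\<in>V. A a j v * B a v j') = (if j = j' then 1 else 0)" if j: "j \<in> J" "j' \<in> J" for j j'
    proof -
      have "(\<Sum>v\<in>V. A a j v * B a v j') = (\<Sum>k<n. A a j (ev k) * B a (ev k) j')"
        by (rule sum.reindex_bij_betw[OF ev, symmetric])
      also have "\<dots> = (\<Sum>k<n. inverse (det (M a)) * (M a $$ (ij j, k) * adj_mat (M a) $$ (k, ij j')))"
        by (rule sum.cong) (simp_all add: B_def ivev Mi ij j)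
      also have "\<dots> = inverse (det (M a)) * ((M a * adj_mat (M a)) $$ (ij j, ij j'))"
        using ij(1)[OF j(1)] ij(1)[OF j(2)] adj(1) Mc[of a]
        by (auto simp: times_mat_def scalar_prod_def atLeast0LessThan sum_distrib_left intro!: sum.cong)
      also have "\<dots> = (if ij j = ij j' then 1 else 0)"
        unfolding adj(2) using ij(1)[OF j(1)] ij(1)[OF j(2)] d0 by simp
      also have "(ij j = ij j') = (j = j')" using ij(2) j by metis
      finally show ?thesis .
    qed
  qed
qed

section \<open>Inverse function theorem\<close>

lemma pts_eqI: "a \<in> pts V \<Longrightarrow> b \<in> pts V \<Longrightarrow> (\<And>v. v \<in> V \<Longrightarrow> a v = b v) \<Longrightarrow> a = b"
  unfolding pts_def fun_eq_iff mem_Collect_eq by metis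

text \<open>The increments of the iterates of \<open>a\<close> are dominated by a geometric series,
  so every coordinate converges. This is Banach's fixed point theorem for the sum norm on a closed
  ball.\<close>

lemma contraction_fixpoint:
  assumes V: "finite V" and a: "a \<in> pts V" and s: "s \<ge> 0"
    and C: "C = {b \<in> pts V. (\<Sum>v\<in>V. \<bar>b v - a v\<bar>) \<le> s}"
    and maps: "\<And>b. b \<in> C \<Longrightarrow> T b \<in> C"
    and contr: "\<And>b c. b \<in> C \<Longrightarrow> c \<in> C \<Longrightarrow> (\<Sum>v\<in>V. \<bar>T b v - T c v\<bar>) \<le> 1/2 * (\<Sum>v\<in>V. \<bar>b v - c v\<bar>)"
  obtains b where "b \<in> C" "T b = b"
proof -
  define x where "x n = (T ^^ n) a" for n
  have xS: "x (Suc n) = T (x n)" for n by (simp add: x_def)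
  have xC: "x n \<in> C" for n
    by (induction n) (use maps a s in \<open>auto simp: x_def C\<close>)
  define D where "D n = (\<Sum>v\<in>V. \<bar>x (Suc n) v - x n v\<bar>)" for n
  have D: "D n \<le> (1/2) ^ n * D 0" for n
  proof (induction n)
    case (Suc n)
    have "D (Suc n) \<le> 1/2 * D n"
      unfolding D_def xS[of n] xS[of "Suc n"] using contr[OF xC[of "Suc n"] xC[of n]] by (simp add: xS)
    with Suc show ?case by simp
  qed simp
  have "\<exists>l. (\<lambda>n. x n v) \<longlonglongrightarrow> l" if "v \<in> V" for v
  proof -
    have bd: "norm (x (Suc n) v - x n v) \<le> (1/2) ^ n * D 0" for n
    proof -
      have "\<bar>x (Suc n) v - x n v\<bar> \<le> D n"
        unfolding D_def by (rule member_le_sum[OF that _ V]) simp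
      with D[of n] show ?thesis by simp
    qed
    have "summable (\<lambda>n. (1/2) ^ n * D 0)"
      by (rule summable_mult2[OF summable_geometric]) simp
    then have "summable (\<lambda>n. x (Suc n) v - x n v)"
      by (rule summable_comparison_test'[where N = 0]) (rule bd)
    then have "(\<lambda>n. \<Sum>k<n. x (Suc k) v - x k v) \<longlonglongrightarrow> (\<Sum>n. x (Suc n) v - x n v)"
      by (rule summable_LIMSEQ)
    then have "(\<lambda>n. (x n v - x 0 v) + x 0 v) \<longlonglongrightarrow> (\<Sum>n. x (Suc n) v - x n v) + x 0 v"
      unfolding sum_lessThan_telescope[of "\<lambda>k. x k v"] by (intro tendsto_add tendsto_const)
    then show ?thesis by auto
  qed
  then obtain l where l: "\<And>v. v \<in> V \<Longrightarrow> (\<lambda>n. x n v) \<longlonglongrightarrow> l v" by metis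
  \<comment> \<open>Only the coordinates in \<open>V\<close> are known to converge; the value 0
    elsewhere puts \<open>b\<close> into \<open>pts V\<close>.\<close>
  define b where "b v = (if v \<in> V then l v else 0)" for v
  have b: "(\<lambda>n. x n v) \<longlonglongrightarrow> b v" if "v \<in> V" for v using l that by (simp add: b_def)
  have "(\<Sum>v\<in>V. \<bar>b v - a v\<bar>) \<le> s"
  proof (rule tendsto_upperbound)
    show "(\<lambda>n. \<Sum>v\<in>V. \<bar>x n v - a v\<bar>) \<longlonglongrightarrow> (\<Sum>v\<in>V. \<bar>b v - a v\<bar>)"
      by (intro tendsto_sum tendsto_rabs tendsto_diff b tendsto_const)
  qed (use xC in \<open>auto simp: C\<close>)
  then have bC: "b \<in> C" by (auto simp: C b_def pts_def)
  \<comment> \<open>The contraction estimate between \<open>b\<close> and the iterate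
    \<open>x n\<close> is passed to the limit, where its right-hand side is 0.\<close>
  have "(\<Sum>v\<in>V. \<bar>T b v - b v\<bar>) \<le> 1/2 * (\<Sum>v\<in>V. \<bar>b v - b v\<bar>)"
  proof (rule tendsto_le)
    show "(\<lambda>n. \<Sum>v\<in>V. \<bar>T b v - x (Suc n) v\<bar>) \<longlonglongrightarrow> (\<Sum>v\<in>V. \<bar>T b v - b v\<bar>)"
      by (intro tendsto_sum tendsto_rabs tendsto_diff LIMSEQ_Suc[OF b] tendsto_const)
    show "(\<lambda>n. 1/2 * (\<Sum>v\<in>V. \<bar>b v - x n v\<bar>)) \<longlonglongrightarrow> 1/2 * (\<Sum>v\<in>V. \<bar>b v - b v\<bar>)"
      by (intro tendsto_sum tendsto_mult tendsto_rabs tendsto_diff b tendsto_const)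
    show "eventually (\<lambda>n. (\<Sum>v\<in>V. \<bar>T b v - x (Suc n) v\<bar>) \<le> 1/2 * (\<Sum>v\<in>V. \<bar>b v - x n v\<bar>)) sequentially"
      unfolding xS by (intro always_eventually allI contr bC xC)
  qed simp
  then have "(\<Sum>v\<in>V. \<bar>T b v - b v\<bar>) = 0" by (simp add: sum_nonneg antisym)
  then have "T b v = b v" if "v \<in> V" for v using that by (simp add: sum_nonneg_eq_0_iff V)
  then have "T b = b" using maps[OF bC] bC by (intro pts_eqI[of _ V]) (auto simp: C)
  with bC show thesis by (rule that)
qed

text \<open>\<open>B a\<close> is a two-sided inverse of the Jacobian at every point of
  \<open>S\<close>. At \<open>p\<close> it is the fixed matrix of Newton's method, at the other
  points it is the derivative of the inverse map.\<close>

locale local_diffeo =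
  fixes V :: "'v set" and J :: "'j set" and S :: "('v \<Rightarrow> real) set" and p :: "'v \<Rightarrow> real"
    and f :: "'j \<Rightarrow> ('v \<Rightarrow> real) \<Rightarrow> real" and B :: "('v \<Rightarrow> real) \<Rightarrow> 'v \<Rightarrow> 'j \<Rightarrow> real"
  assumes V: "finite V" and J: "finite J" and S: "opn V S" and p: "p \<in> S"
    and f: "\<And>j. j \<in> J \<Longrightarrow> smooth_on V S (f j)"
    and B: "\<And>v j. v \<in> V \<Longrightarrow> j \<in> J \<Longrightarrow> smooth_on V S (\<lambda>a. B a v j)"
    and BA: "\<And>a v v'. a \<in> S \<Longrightarrow> v \<in> V \<Longrightarrow> v' \<in> V \<Longrightarrow>
      (\<Sum>j\<in>J. B a v j * pdiff (f j) v' a) = (if v = v' then 1 else 0)"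
    and AB: "\<And>a j j'. a \<in> S \<Longrightarrow> j \<in> J \<Longrightarrow> j' \<in> J \<Longrightarrow>
      (\<Sum>v\<in>V. pdiff (f j) v a * B a v j') = (if j = j' then 1 else 0)"
begin

text \<open>The value 0 outside \<open>J\<close> puts the image into \<open>pts J\<close>.\<close>

definition F :: "('v \<Rightarrow> real) \<Rightarrow> 'j \<Rightarrow> real" where
  "F a j = (if j \<in> J then f j a else 0)"

text \<open>The part of the Newton step that does not involve the target: the solutions of
  \<open>F a = w\<close> are the fixed points of
  \<open>a \<mapsto> \<phi> a + B p w\<close>.\<close>

definition \<phi> :: "'v \<Rightarrow> ('v \<Rightarrow> real) \<Rightarrow> real" where
  "\<phi> v a = a v - (\<Sum>j\<in>J. B p v j * f j a)"

text \<open>The Jacobian of \<open>\<phi>\<close> is the identity minus \<open>B p\<close> times the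
  Jacobian of \<open>f\<close>. It vanishes at \<open>p\<close>, hence is small on a box around
  \<open>p\<close>.\<close>

lemma phi_contraction:
  obtains e where "e > 0" "bx V p e \<subseteq> S"
    "\<And>a b. a \<in> bx V p e \<Longrightarrow> b \<in> bx V p e \<Longrightarrow>
      (\<Sum>v\<in>V. \<bar>\<phi> v b - \<phi> v a\<bar>) \<le> 1/2 * (\<Sum>v\<in>V. \<bar>b v - a v\<bar>)"
proof -
  \<comment> \<open>Summing the estimates for the \<open>card V\<close> coordinates gives the factor
    \<open>card V * \<kappa>\<close>, which is at most 1/2. The summand 1 keeps the denominator
    positive when \<open>V\<close> is empty.\<close>
  define \<kappa> where "\<kappa> = 1 / (2 * (real (card V) + 1))"
  define D where "D v v' a = (if v' = v then 1 else 0) - (\<Sum>j\<in>J. B p v j * pdiff (f j) v' a)" for v v' a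
  have \<kappa>: "\<kappa> > 0" by (simp add: \<kappa>_def add_nonneg_pos)
  have "eventually (\<lambda>a. \<bar>D v v' a\<bar> < \<kappa>) (nbh V S p)" if v: "v \<in> V" "v' \<in> V" for v v'
  proof -
    have "(D v v' \<longlongrightarrow> D v v' p) (nbh V S p)"
      unfolding D_def
      by (intro tendsto_diff tendsto_sum tendsto_mult tendsto_const)
         (rule cont_onD[OF ck_on_cont[OF ck_on_pdiff[OF smooth_onD[OF f, of _ "Suc 0"]]] p], use v in auto)
    moreover have "D v v' p = 0" using BA[OF p v] by (simp add: D_def)
    ultimately show ?thesis using \<kappa> unfolding tendsto_iff dist_real_def by simp
  qed
  then have "eventually (\<lambda>a. \<forall>v\<in>V. \<forall>v'\<in>V. \<bar>D v v' a\<bar> < \<kappa>) (nbh V S p)"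
    by (intro eventually_ball_finite V ballI)
  then have "eventually (\<lambda>a. a \<in> S \<and> (\<forall>v\<in>V. \<forall>v'\<in>V. \<bar>D v v' a\<bar> < \<kappa>)) (nbh V (pts V) p)"
    using eventually_nbh_self unfolding nbh_opn[OF S p, symmetric] by (rule eventually_elim2) simp
  then obtain e where e: "e > 0" "bx V p e \<subseteq> S"
    "\<And>a v v'. a \<in> bx V p e \<Longrightarrow> v \<in> V \<Longrightarrow> v' \<in> V \<Longrightarrow> \<bar>D v v' a\<bar> < \<kappa>"
    unfolding eventually_nbh bx_def by blast
  show thesis
  proof (rule that[OF e(1,2)])
    fix a b assume a: "a \<in> bx V p e" and b: "b \<in> bx V p e"
    have "\<bar>\<phi> v b - \<phi> v a\<bar> \<le> \<kappa> * (\<Sum>v\<in>V. \<bar>b v - a v\<bar>)" if v: "v \<in> V" for v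
    proof (rule box_mean_value[OF V a b, where D = "D v"])
      fix v' z assume v': "v' \<in> V" and z: "z \<in> bx V p e"
      show "\<bar>D v v' z\<bar> \<le> \<kappa>" using e(3)[OF z v v'] by simp
      have "((\<lambda>h. (z(v' := z v' + h)) v) has_real_derivative (if v' = v then 1 else 0)) (at 0)"
        by (auto intro!: derivative_eq_intros)
      then show "((\<lambda>h. \<phi> v (z(v' := z v' + h))) has_real_derivative D v v' z) (at 0)"
        unfolding \<phi>_def D_def
        by (intro DERIV_diff DERIV_sum DERIV_cmult)
           (auto intro!: ck_on_pderiv[OF smooth_onD[OF f, of _ "Suc 0"]] v' simp: subsetD[OF e(2) z])
    qed
    then have "(\<Sum>v\<in>V. \<bar>\<phi> v b - \<phi> v a\<bar>) \<le> of_nat (card V) * (\<kappa> * (\<Sum>v\<in>V. \<bar>b v - a v\<bar>))"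
      by (intro sum_bounded_above)
    also have "\<dots> = (real (card V) * \<kappa>) * (\<Sum>v\<in>V. \<bar>b v - a v\<bar>)" by simp
    also have "\<dots> \<le> 1/2 * (\<Sum>v\<in>V. \<bar>b v - a v\<bar>)"
      by (intro mult_right_mono sum_nonneg) (auto simp: \<kappa>_def divide_simps)
    finally show "(\<Sum>v\<in>V. \<bar>\<phi> v b - \<phi> v a\<bar>) \<le> 1/2 * (\<Sum>v\<in>V. \<bar>b v - a v\<bar>)" .
  qed
qed

section \<open>Injectivity and openness on a box where \<open>\<phi>\<close> contracts\<close>

context
  fixes e :: real
  assumes e: "e > 0" and QS: "bx V p e \<subseteq> S"
    and contr: "\<And>a b. a \<in> bx V p e \<Longrightarrow> b \<in> bx V p e \<Longrightarrow>
      (\<Sum>v\<in>V. \<bar>\<phi> v b - \<phi> v a\<bar>) \<le> 1/2 * (\<Sum>v\<in>V. \<bar>b v - a v\<bar>)"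
begin

text \<open>The increment \<open>b - a\<close> is that of \<open>\<phi>\<close> plus
  \<open>B p\<close> applied to that of \<open>F\<close>. The first part is at most half of the
  left-hand side and is absorbed.\<close>

lemma F_expanding:
  assumes "a \<in> bx V p e" "b \<in> bx V p e"
  shows "(\<Sum>v\<in>V. \<bar>b v - a v\<bar>) \<le> 2 * (\<Sum>v\<in>V. \<bar>\<Sum>j\<in>J. B p v j * (F b j - F a j)\<bar>)"
proof -
  have "(\<Sum>v\<in>V. \<bar>b v - a v\<bar>) \<le> (\<Sum>v\<in>V. \<bar>\<phi> v b - \<phi> v a\<bar> + \<bar>\<Sum>j\<in>J. B p v j * (F b j - F a j)\<bar>)"
  proof (rule sum_mono)
    fix v assume "v \<in> V"
    have "b v - a v = (\<phi> v b - \<phi> v a) + (\<Sum>j\<in>J. B p v j * (F b j - F a j))"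
      by (simp add: \<phi>_def F_def right_diff_distrib sum_subtractf)
    then show "\<bar>b v - a v\<bar> \<le> \<bar>\<phi> v b - \<phi> v a\<bar> + \<bar>\<Sum>j\<in>J. B p v j * (F b j - F a j)\<bar>" by linarith
  qed
  then show ?thesis using contr[OF assms] unfolding sum.distrib by linarith
qed

lemma F_inj: "inj_on F (bx V p e)"
proof (rule inj_onI)
  fix a b assume ab: "a \<in> bx V p e" "b \<in> bx V p e" "F a = F b"
  have "(\<Sum>v\<in>V. \<bar>b v - a v\<bar>) \<le> 0" using F_expanding[OF ab(1,2)] ab(3) by simp
  then have "(\<Sum>v\<in>V. \<bar>b v - a v\<bar>) = 0" by (simp add: sum_nonneg antisym)
  then show "a = b" using ab bx_sub_pts[of V p e] by (intro pts_eqI[of _ V]) (auto simp: sum_nonneg_eq_0_iff V)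
qed

text \<open>For \<open>w\<close> near \<open>y = F a\<close> the Newton map
  \<open>b \<mapsto> \<phi> b + B p w\<close> contracts a closed ball around \<open>a\<close> into
  itself. Its fixed point \<open>b\<close> satisfies \<open>B p (w - F b) = 0\<close>, hence
  \<open>F b = w\<close>.\<close>

lemma F_open: "opn J (F ` bx V p e)"
  unfolding opn_iff_eventually
proof (intro conjI ballI)
  show "F ` bx V p e \<subseteq> pts J" by (auto simp: pts_def F_def)
  fix y assume "y \<in> F ` bx V p e"
  then obtain a where a: "a \<in> bx V p e" and y: "y = F a" by blast
  obtain d where d: "d > 0" "bx V a d \<subseteq> bx V p e" by (rule opn_bxE[OF opn_bx[OF V] a])
  \<comment> \<open>Radius \<open>d/2\<close> in the sum norm keeps the closed ball inside the open
    box of half-width \<open>d\<close>.\<close>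
  define C where "C = {b \<in> pts V. (\<Sum>v\<in>V. \<bar>b v - a v\<bar>) \<le> d/2}"
  have apts: "a \<in> pts V" using a bx_sub_pts by blast
  have CQ: "C \<subseteq> bx V p e"
  proof -
    have "\<bar>b v - a v\<bar> < d" if "b \<in> C" "v \<in> V" for b v
    proof -
      have "\<bar>b v - a v\<bar> \<le> (\<Sum>v\<in>V. \<bar>b v - a v\<bar>)" by (rule member_le_sum[OF that(2) _ V]) simp
      then show ?thesis using that(1) d(1) by (simp add: C_def)
    qed
    then have "C \<subseteq> bx V a d" by (auto simp: bx_def C_def)
    with d(2) show ?thesis by blast
  qed
  have aC: "a \<in> C" using apts d(1) by (simp add: C_def)
  have "((\<lambda>w. \<Sum>v\<in>V. \<bar>\<Sum>j\<in>J. B p v j * (w j - y j)\<bar>) \<longlongrightarrow>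
      (\<Sum>v\<in>V. \<bar>\<Sum>j\<in>J. B p v j * (y j - y j)\<bar>)) (nbh J (pts J) y)"
    by (intro tendsto_sum tendsto_rabs tendsto_mult tendsto_diff tendsto_const tendsto_nbh_coord)
  \<comment> \<open>With this bound \<open>T\<close> moves the centre \<open>a\<close> by less than
    \<open>d/4\<close>, and it maps \<open>C\<close> into distance \<open>d/4\<close> of
    \<open>T a\<close>; together this stays within \<open>d/2\<close>.\<close>
  then have "eventually (\<lambda>w. (\<Sum>v\<in>V. \<bar>\<Sum>j\<in>J. B p v j * (w j - y j)\<bar>) < d/4) (nbh J (pts J) y)"
    by (rule order_tendstoD(2)) (use d(1) in simp)
  with eventually_nbh_self show "eventually (\<lambda>w. w \<in> F ` bx V p e) (nbh J (pts J) y)"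
  proof eventually_elim
    case (elim w)
    define T where "T b v = (if v \<in> V then \<phi> v b + (\<Sum>j\<in>J. B p v j * w j) else 0)" for b v
    have Tc: "(\<Sum>v\<in>V. \<bar>T b v - T c v\<bar>) \<le> 1/2 * (\<Sum>v\<in>V. \<bar>b v - c v\<bar>)" if "b \<in> C" "c \<in> C" for b c
    proof -
      have "(\<Sum>v\<in>V. \<bar>T b v - T c v\<bar>) = (\<Sum>v\<in>V. \<bar>\<phi> v b - \<phi> v c\<bar>)"
        by (rule sum.cong) (simp_all add: T_def)
      then show ?thesis using contr[of c b] that CQ by auto
    qed
    have Ta: "(\<Sum>v\<in>V. \<bar>T a v - a v\<bar>) = (\<Sum>v\<in>V. \<bar>\<Sum>j\<in>J. B p v j * (w j - y j)\<bar>)"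
      by (rule sum.cong) (simp_all add: T_def \<phi>_def y F_def right_diff_distrib sum_subtractf)
    have TC: "T b \<in> C" if b: "b \<in> C" for b
    proof -
      have "(\<Sum>v\<in>V. \<bar>T b v - a v\<bar>) \<le> (\<Sum>v\<in>V. \<bar>T b v - T a v\<bar> + \<bar>T a v - a v\<bar>)"
        by (rule sum_mono) linarith
      also have "\<dots> \<le> 1/2 * (\<Sum>v\<in>V. \<bar>b v - a v\<bar>) + d/4"
        unfolding sum.distrib using Tc[OF b aC] Ta elim(2) by linarith
      also have "\<dots> \<le> d/2" using b by (simp add: C_def)
      finally show ?thesis by (simp add: C_def pts_def T_def)
    qed
    obtain b where b: "b \<in> C" "T b = b"
      using contraction_fixpoint[OF V apts _ C_def TC Tc] d(1) by (metis divide_nonneg_nonneg less_imp_le zero_le_numeral)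
    have z: "(\<Sum>j\<in>J. B p v j * (w j - f j b)) = 0" if "v \<in> V" for v
      using fun_cong[OF b(2), of v] that by (simp add: T_def \<phi>_def right_diff_distrib sum_subtractf)
    have "w i = f i b" if i: "i \<in> J" for i
    proof -
      \<comment> \<open>The Jacobian at \<open>p\<close> is applied to the vanishing vector
        \<open>B p (w - F b)\<close>; by \<open>AB\<close> it cancels \<open>B p\<close>.\<close>
      have "0 = (\<Sum>v\<in>V. pdiff (f i) v p * (\<Sum>j\<in>J. B p v j * (w j - f j b)))" by (simp add: z)
      also have "\<dots> = (\<Sum>v\<in>V. \<Sum>j\<in>J. pdiff (f i) v p * B p v j * (w j - f j b))"
        by (simp add: sum_distrib_left mult.assoc)
      also have "\<dots> = (\<Sum>j\<in>J. (\<Sum>v\<in>V. pdiff (f i) v p * B p v j) * (w j - f j b))"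
        by (subst sum.swap) (simp add: sum_distrib_right)
      also have "\<dots> = (\<Sum>j\<in>J. if i = j then w j - f j b else 0)"
        by (rule sum.cong) (simp_all add: AB[OF p i])
      also have "\<dots> = w i - f i b" using i J by simp
      finally show ?thesis by simp
    qed
    then have "w = F b" using elim(1) by (intro pts_eqI[of _ J]) (auto simp: pts_def F_def)
    then show ?case using b(1) CQ by blast
  qed
qed

section \<open>Continuity and smoothness of the local inverse\<close>

definition \<Phi> :: "('j \<Rightarrow> real) \<Rightarrow> 'v \<Rightarrow> real" where
  "\<Phi> = inv_into (bx V p e) F"

lemma Phi_F: "a \<in> bx V p e \<Longrightarrow> \<Phi> (F a) = a"
  unfolding \<Phi>_def by (rule inv_into_f_f[OF F_inj])

lemma Phi_in: "w \<in> F ` bx V p e \<Longrightarrow> \<Phi> w \<in> bx V p e"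
  and F_Phi: "w \<in> F ` bx V p e \<Longrightarrow> F (\<Phi> w) = w"
  by (auto simp: Phi_F)

lemma Phi_lipschitz:
  assumes "w \<in> F ` bx V p e" "w' \<in> F ` bx V p e" "v \<in> V"
  shows "\<bar>\<Phi> w' v - \<Phi> w v\<bar> \<le> 2 * (\<Sum>v\<in>V. \<bar>\<Sum>j\<in>J. B p v j * (w' j - w j)\<bar>)"
proof -
  have "\<bar>\<Phi> w' v - \<Phi> w v\<bar> \<le> (\<Sum>v\<in>V. \<bar>\<Phi> w' v - \<Phi> w v\<bar>)" by (rule member_le_sum[OF assms(3) _ V]) simp
  also have "\<dots> \<le> 2 * (\<Sum>v\<in>V. \<bar>\<Sum>j\<in>J. B p v j * (w' j - w j)\<bar>)"
    using F_expanding[OF Phi_in[OF assms(1)] Phi_in[OF assms(2)]] by (simp add: F_Phi assms)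
  finally show ?thesis .
qed

lemma Phi_cont:
  assumes "v \<in> V" shows "cont_on J (F ` bx V p e) (\<lambda>w. \<Phi> w v)"
proof (rule cont_onI)
  fix w assume w: "w \<in> F ` bx V p e"
  let ?N = "nbh J (F ` bx V p e) w"
  have "((\<lambda>w'. 2 * (\<Sum>v\<in>V. \<bar>\<Sum>j\<in>J. B p v j * (w' j - w j)\<bar>)) \<longlongrightarrow>
      2 * (\<Sum>v\<in>V. \<bar>\<Sum>j\<in>J. B p v j * (w j - w j)\<bar>)) ?N"
    by (intro tendsto_sum tendsto_rabs tendsto_mult tendsto_diff tendsto_const tendsto_nbh_coord)
  then have "((\<lambda>w'. 2 * (\<Sum>v\<in>V. \<bar>\<Sum>j\<in>J. B p v j * (w' j - w j)\<bar>)) \<longlongrightarrow> 0) ?N" by simp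
  moreover have "eventually (\<lambda>w'. norm (\<Phi> w' v - \<Phi> w v) \<le> 2 * (\<Sum>v\<in>V. \<bar>\<Sum>j\<in>J. B p v j * (w' j - w j)\<bar>)) ?N"
    using eventually_nbh_self by eventually_elim (use Phi_lipschitz[OF w _ assms] in simp)
  ultimately have "((\<lambda>w'. \<Phi> w' v - \<Phi> w v) \<longlongrightarrow> 0) ?N" by (rule Lim_null_comparison[rotated])
  then show "((\<lambda>w. \<Phi> w v) \<longlongrightarrow> \<Phi> w v) ?N" by (simp add: Lim_null[symmetric])
qed

text \<open>\<open>c h\<close> is the preimage of \<open>w\<close> moved by \<open>h\<close> in
  coordinate \<open>i\<close>. The expansions of all \<open>f j\<close> at \<open>a\<close>,
  multiplied by \<open>B a\<close>, isolate \<open>c h v - a v\<close>. The remainder is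
  \<open>o(h)\<close>, because the distance \<open>n h\<close> from \<open>a\<close> to
  \<open>c h\<close> is at most \<open>K * \<bar>h\<bar>\<close>.\<close>

lemma Phi_deriv:
  assumes w: "w \<in> F ` bx V p e" and i: "i \<in> J" and v: "v \<in> V"
  shows "((\<lambda>h. \<Phi> (w(i := w i + h)) v) has_real_derivative B (\<Phi> w) v i) (at 0)"
proof -
  define Q where "Q = bx V p e"
  define a where "a = \<Phi> w"
  define c where "c h = \<Phi> (w(i := w i + h))" for h
  define n where "n h = (\<Sum>v\<in>V. \<bar>c h v - a v\<bar>)" for h
  \<comment> \<open>The constant that \<open>F_expanding\<close> gives when \<open>F\<close> changes
    in coordinate \<open>i\<close> alone.\<close>
  define K where "K = 2 * (\<Sum>v\<in>V. \<bar>B p v i\<bar>)"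
  have Q: "opn V Q" unfolding Q_def by (rule opn_bx[OF V])
  have aQ: "a \<in> Q" using Phi_in[OF w] by (simp add: a_def Q_def)
  have Fa: "F a = w" by (simp add: a_def F_Phi w)
  have "eventually (\<lambda>h. w(i := w i + h) \<in> F ` Q) (at 0)"
    using eventually_upd[OF F_open w i] unfolding eventually_at_filter Q_def by eventually_elim blast
  then have ev: "eventually (\<lambda>h. c h \<in> Q \<and> F (c h) = w(i := w i + h)) (at 0)"
    by eventually_elim (auto simp: c_def Q_def intro!: Phi_in F_Phi)
  have lip: "n h \<le> K * \<bar>h\<bar>" if "c h \<in> Q" "F (c h) = w(i := w i + h)" for h
  proof -
    have "(\<Sum>j\<in>J. B p v j * (F (c h) j - F a j)) = B p v i * h" for v
    proof -
      have "(\<Sum>j\<in>J. B p v j * (F (c h) j - F a j)) = (\<Sum>j\<in>J. if j = i then B p v j * h else 0)"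
        by (rule sum.cong) (auto simp: that(2) Fa)
      then show ?thesis using i J by simp
    qed
    moreover have "n h \<le> 2 * (\<Sum>v\<in>V. \<bar>\<Sum>j\<in>J. B p v j * (F (c h) j - F a j)\<bar>)"
      unfolding n_def by (rule F_expanding) (use aQ that Q_def in auto)
    ultimately show ?thesis by (simp add: K_def abs_mult flip: sum_distrib_right)
  qed
  have nlim: "(n \<longlongrightarrow> 0) (at 0)"
  proof (rule Lim_null_comparison)
    show "eventually (\<lambda>h. norm (n h) \<le> K * \<bar>h\<bar>) (at 0)"
      using ev
    proof eventually_elim
      case (elim h)
      moreover have "n h \<ge> 0" by (simp add: n_def sum_nonneg)
      ultimately show ?case using lip[of h] by simp
    qed
    have "((\<lambda>h. K * \<bar>h\<bar>) \<longlongrightarrow> K * \<bar>0\<bar>) (at 0)" by (intro tendsto_intros)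
    then show "((\<lambda>h. K * \<bar>h\<bar>) \<longlongrightarrow> 0) (at 0)" by simp
  qed
  have clim: "filterlim c (nbh V Q a) (at 0)"
  proof (rule filterlim_nbh[OF V])
    show "eventually (\<lambda>h. c h \<in> Q) (at 0)" using ev by eventually_elim simp
    fix v assume v: "v \<in> V"
    have "((\<lambda>h. c h v - a v) \<longlongrightarrow> 0) (at 0)"
    proof (rule Lim_null_comparison[OF _ nlim], intro always_eventually allI)
      fix h show "norm (c h v - a v) \<le> n h"
        unfolding n_def real_norm_def by (rule member_le_sum[OF v _ V]) simp
    qed
    then show "((\<lambda>h. c h v) \<longlongrightarrow> a v) (at 0)" by (simp add: Lim_null[symmetric])
  qed
  have "\<forall>j\<in>J. \<exists>\<theta>. (\<theta> \<longlongrightarrow> 0) (nbh V Q a) \<and>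
      (\<forall>b\<in>Q. f j b - f j a = (\<Sum>v\<in>V. pdiff (f j) v a * (b v - a v)) + \<theta> b * (\<Sum>v\<in>V. \<bar>b v - a v\<bar>))"
  proof
    fix j assume "j \<in> J"
    then have "ck_on (Suc 0) V Q (f j)"
      unfolding Q_def by (rule ck_on_subset[OF smooth_onD[OF f] QS])
    then show "\<exists>\<theta>. (\<theta> \<longlongrightarrow> 0) (nbh V Q a) \<and>
      (\<forall>b\<in>Q. f j b - f j a = (\<Sum>v\<in>V. pdiff (f j) v a * (b v - a v)) + \<theta> b * (\<Sum>v\<in>V. \<bar>b v - a v\<bar>))"
      by (rule remainder_split[OF V Q _ aQ]) blast
  qed
  from bchoice[OF this] obtain \<theta> where \<theta>_all: "\<forall>j\<in>J. (\<theta> j \<longlongrightarrow> 0) (nbh V Q a) \<and>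
      (\<forall>b\<in>Q. f j b - f j a = (\<Sum>v\<in>V. pdiff (f j) v a * (b v - a v)) + \<theta> j b * (\<Sum>v\<in>V. \<bar>b v - a v\<bar>))"
    by (rule exE)
  have \<theta>: "(\<theta> j \<longlongrightarrow> 0) (nbh V Q a)"
    "\<And>b. b \<in> Q \<Longrightarrow>
      f j b - f j a = (\<Sum>v\<in>V. pdiff (f j) v a * (b v - a v)) + \<theta> j b * (\<Sum>v\<in>V. \<bar>b v - a v\<bar>)"
    if "j \<in> J" for j
    using bspec[OF \<theta>_all that] by (simp_all)
  define r where "r h = (\<Sum>j\<in>J. B a v j * \<theta> j (c h))" for h
  have rlim: "(r \<longlongrightarrow> 0) (at 0)"
  proof -
    have "(r \<longlongrightarrow> (\<Sum>j\<in>J. B a v j * 0)) (at 0)" unfolding r_def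
      by (intro tendsto_sum tendsto_mult tendsto_const filterlim_compose[OF \<theta>(1) clim])
    then show ?thesis by simp
  qed
  \<comment> \<open>The expansion is at \<open>a\<close>, so the matrix that inverts its linear part
    is \<open>B a\<close> and not \<open>B p\<close>.\<close>
  have key: "c h v - a v = h * B a v i - r h * n h" if h: "c h \<in> Q" "F (c h) = w(i := w i + h)" for h
  proof -
    have "(\<Sum>j\<in>J. B a v j * (F (c h) j - F a j)) = (\<Sum>j\<in>J. if j = i then B a v j * h else 0)"
      by (rule sum.cong) (auto simp: h(2) Fa)
    also have "\<dots> = h * B a v i" using i J by simp
    finally have 1: "(\<Sum>j\<in>J. B a v j * (F (c h) j - F a j)) = h * B a v i" .
    have "(\<Sum>j\<in>J. B a v j * (F (c h) j - F a j)) =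
        (\<Sum>j\<in>J. B a v j * (\<Sum>v'\<in>V. pdiff (f j) v' a * (c h v' - a v'))) + r h * n h"
    proof -
      have "(\<Sum>j\<in>J. B a v j * (F (c h) j - F a j)) =
          (\<Sum>j\<in>J. B a v j * (\<Sum>v'\<in>V. pdiff (f j) v' a * (c h v' - a v')) + B a v j * \<theta> j (c h) * n h)"
        by (rule sum.cong) (simp_all add: F_def \<theta>(2)[OF _ h(1)] n_def distrib_left mult.assoc)
      then show ?thesis by (simp add: sum.distrib r_def sum_distrib_right)
    qed
    also have "(\<Sum>j\<in>J. B a v j * (\<Sum>v'\<in>V. pdiff (f j) v' a * (c h v' - a v'))) =
        (\<Sum>v'\<in>V. (\<Sum>j\<in>J. B a v j * pdiff (f j) v' a) * (c h v' - a v'))"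
      unfolding sum_distrib_left sum_distrib_right by (subst sum.swap) (simp add: mult.assoc)
    also have "\<dots> = (\<Sum>v'\<in>V. if v = v' then c h v' - a v' else 0)"
      by (rule sum.cong) (use BA[OF subsetD[OF QS] v] aQ in \<open>simp_all add: Q_def\<close>)
    also have "\<dots> = c h v - a v" using v V by simp
    finally show ?thesis using 1 by simp
  qed
  have rn: "((\<lambda>h. r h * n h / h) \<longlongrightarrow> 0) (at 0)"
  proof (rule Lim_null_comparison)
    show "eventually (\<lambda>h. norm (r h * n h / h) \<le> K * \<bar>r h\<bar>) (at 0)"
      using ev
    proof eventually_elim
      case (elim h)
      have n0: "n h \<ge> 0" by (simp add: n_def sum_nonneg)
      have K0: "K \<ge> 0" by (simp add: K_def sum_nonneg)
      \<comment> \<open>At \<open>h = 0\<close> the quotient is 0 by convention, and the bound is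
        \<open>K0\<close>.\<close>
      have "n h / \<bar>h\<bar> \<le> K"
        using lip[of h] elim K0 by (cases "h = 0") (auto simp: divide_le_eq)
      then have "\<bar>r h\<bar> * (n h / \<bar>h\<bar>) \<le> \<bar>r h\<bar> * K" by (rule mult_left_mono) simp
      then show ?case using n0 by (simp add: abs_mult abs_divide mult.commute)
    qed
    have "((\<lambda>h. K * \<bar>r h\<bar>) \<longlongrightarrow> K * \<bar>0\<bar>) (at 0)" by (intro tendsto_intros rlim)
    then show "((\<lambda>h. K * \<bar>r h\<bar>) \<longlongrightarrow> 0) (at 0)" by simp
  qed
  have "((\<lambda>h. (c h v - c 0 v) / (h - 0)) \<longlongrightarrow> B a v i) (at 0)"
  proof (rule Lim_transform_eventually)
    show "((\<lambda>h. B a v i - r h * n h / h) \<longlongrightarrow> B a v i) (at 0)"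
      using tendsto_diff[OF tendsto_const rn, of "B a v i"] by simp
    have c0: "c 0 = a" by (simp add: c_def a_def)
    have "eventually (\<lambda>h. h \<noteq> (0::real)) (at 0)" by (simp add: eventually_at_filter)
    with ev show "eventually (\<lambda>h. B a v i - r h * n h / h = (c h v - c 0 v) / (h - 0)) (at 0)"
    proof eventually_elim
      case (elim h)
      then show ?case using key[of h] by (simp add: c0 diff_divide_distrib)
    qed
  qed
  then show ?thesis by (simp only: has_field_derivative_iff c_def a_def)
qed

text \<open>Bootstrapping: the partial derivatives of \<open>\<Phi>\<close> are the entries of
  \<open>B (\<Phi> w)\<close>, so they have at least the order of smoothness already known for
  \<open>\<Phi>\<close>. All coordinates are treated at once, since \<open>B\<close> is composed
  with the whole of \<open>\<Phi>\<close>.\<close>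

lemma Phi_smooth:
  assumes "v \<in> V" shows "smooth_on J (F ` bx V p e) (\<lambda>w. \<Phi> w v)"
proof -
  have "\<forall>v\<in>V. ck_on n J (F ` bx V p e) (\<lambda>w. \<Phi> w v)" for n
  proof (induction n)
    case 0
    then show ?case by (simp add: Phi_cont)
  next
    case (Suc n)
    show ?case
    proof
      fix v assume v: "v \<in> V"
      show "ck_on (Suc n) J (F ` bx V p e) (\<lambda>w. \<Phi> w v)"
      proof (rule ck_on_SucI[OF F_open Phi_cont[OF v], where D = "\<lambda>i w. B (\<Phi> w) v i"])
        fix i assume i: "i \<in> J"
        show "ck_on n J (F ` bx V p e) (\<lambda>w. B (\<Phi> w) v i)"
          by (rule ck_on_compose[OF V S F_open smooth_onD[OF B[OF v i]]])
             (use Suc subsetD[OF QS Phi_in] in auto)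
      qed (rule Phi_deriv[OF _ _ v])
    qed
  qed
  then show ?thesis using assms by (simp add: smooth_on_def)
qed

end

theorem inverse_function:
  obtains e W \<Phi> where "e > 0" "bx V p e \<subseteq> S" "opn J W" "\<And>v. v \<in> V \<Longrightarrow> smooth_on J W (\<lambda>w. \<Phi> w v)"
    "\<And>a. a \<in> bx V p e \<Longrightarrow> F a \<in> W" "\<And>a. a \<in> bx V p e \<Longrightarrow> \<Phi> (F a) = a"
proof -
  obtain e where e: "e > 0" "bx V p e \<subseteq> S"
    "\<And>a b. a \<in> bx V p e \<Longrightarrow> b \<in> bx V p e \<Longrightarrow>
      (\<Sum>v\<in>V. \<bar>\<phi> v b - \<phi> v a\<bar>) \<le> 1/2 * (\<Sum>v\<in>V. \<bar>b v - a v\<bar>)"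
    using phi_contraction by blast
  show thesis
    by (rule that[OF e(1,2) F_open[OF e] Phi_smooth[OF e] _ Phi_F[OF e]]) auto
qed

end

section \<open>Triangular systems\<close>

lemma smooth_on_pdiff: "smooth_on V S g \<Longrightarrow> v \<in> V \<Longrightarrow> smooth_on V S (pdiff g v)"
  unfolding smooth_on_def by (metis ck_on_pdiff)

lemma smooth_on_subset: "smooth_on V S g \<Longrightarrow> S' \<subseteq> S \<Longrightarrow> smooth_on V S' g"
  unfolding smooth_on_def by (metis ck_on_subset)

lemma pdiff_zero:
  assumes "opn V U" "a \<in> U" "v \<in> V" and "\<And>h. a(v := a v + h) \<in> U \<Longrightarrow> g (a(v := a v + h)) = g a"
  shows "pdiff g v a = 0"
proof (rule pdiff_eqI)
  have "((\<lambda>h. g a) has_real_derivative 0) (at 0)" by simp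
  moreover have "eventually (\<lambda>h. g (a(v := a v + h)) = g a) (nhds 0)"
    using eventually_upd[OF assms(1-3)] by eventually_elim (rule assms(4))
  ultimately show "((\<lambda>h. g (a(v := a v + h))) has_real_derivative 0) (at 0)"
    by (subst DERIV_cong_ev[OF refl _ refl])
qed

text \<open>\<open>cv j q\<close> is the coordinate of order \<open>j\<close>; order \<open>r + 1\<close> is the input.
  \<open>G j q\<close> is the right-hand side of the equation for \<open>cv j q\<close>.\<close>

locale triangular_system =
  fixes r :: nat and Q :: "'q set" and cv :: "nat \<Rightarrow> 'q \<Rightarrow> 'v" and V :: "'v set"
    and U :: "('v \<Rightarrow> real) set" and p :: "'v \<Rightarrow> real"
    and G :: "nat \<Rightarrow> 'q \<Rightarrow> ('v \<Rightarrow> real) \<Rightarrow> real"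
  assumes Q: "finite Q"
    and cv: "bij_betw (\<lambda>(j, q). cv j q) ({1..Suc r} \<times> Q) V"
    and U: "opn V U" and p: "p \<in> U"
    and smooth: "\<And>j q. 1 \<le> j \<Longrightarrow> j \<le> r \<Longrightarrow> q \<in> Q \<Longrightarrow> smooth_on V U (G j q)"
    and dep_G: "\<And>j q a b. 1 \<le> j \<Longrightarrow> j \<le> r \<Longrightarrow> q \<in> Q \<Longrightarrow> a \<in> U \<Longrightarrow> b \<in> U \<Longrightarrow>
      (\<And>i s. 1 \<le> i \<Longrightarrow> i \<le> Suc j \<Longrightarrow> s \<in> Q \<Longrightarrow> a (cv i s) = b (cv i s)) \<Longrightarrow> G j q a = G j q b"
    and ker_G: "\<And>j \<eta> s. 1 \<le> j \<Longrightarrow> j \<le> r \<Longrightarrow>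
      (\<And>q. q \<in> Q \<Longrightarrow> (\<Sum>s\<in>Q. pdiff (G j q) (cv (Suc j) s) p * \<eta> s) = 0) \<Longrightarrow> s \<in> Q \<Longrightarrow> \<eta> s = 0"
begin

text \<open>Points are compared only inside \<open>U\<close>, because triangularity of
  \<open>G\<close> is assumed only there.\<close>

definition dep :: "nat \<Rightarrow> (('v \<Rightarrow> real) \<Rightarrow> real) \<Rightarrow> bool" where
  "dep l g \<longleftrightarrow> (\<forall>a\<in>U. \<forall>b\<in>U. (\<forall>j q. 1 \<le> j \<and> j \<le> l \<and> q \<in> Q \<longrightarrow> a (cv j q) = b (cv j q)) \<longrightarrow> g a = g b)"

lemma finite_V: "finite V"
  using bij_betw_finite[OF cv] Q by simp

lemma cv_in: "1 \<le> j \<Longrightarrow> j \<le> Suc r \<Longrightarrow> q \<in> Q \<Longrightarrow> cv j q \<in> V"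
  using bij_betwE[OF cv] by auto

lemma V_cases:
  assumes "v \<in> V" obtains j q where "1 \<le> j" "j \<le> Suc r" "q \<in> Q" "v = cv j q"
proof -
  have "v \<in> (\<lambda>(j, q). cv j q) ` ({1..Suc r} \<times> Q)" using assms bij_betw_imp_surj_on[OF cv] by simp
  then show thesis by (auto intro: that)
qed

lemma cv_eq:
  assumes "1 \<le> j" "j \<le> Suc r" "q \<in> Q" "1 \<le> i" "i \<le> Suc r" "s \<in> Q"
  shows "cv j q = cv i s \<longleftrightarrow> j = i \<and> q = s"
  using inj_onD[OF bij_betw_imp_inj_on[OF cv], of "(j, q)" "(i, s)"] assms by auto

lemma sum_V: "(\<Sum>v\<in>V. g v) = (\<Sum>j = 1..Suc r. \<Sum>q\<in>Q. g (cv j q))"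
  using sum.reindex_bij_betw[OF cv, of g] by (simp add: sum.cartesian_product case_prod_unfold)

text \<open>Moving the same coordinate by the same \<open>h\<close> in both points preserves their
  agreement up to order \<open>l\<close>, so the difference quotients coincide for small
  \<open>h\<close>.\<close>

lemma dep_pdiff:
  assumes "dep l g" "v \<in> V" shows "dep l (pdiff g v)"
  unfolding dep_def
proof (intro ballI impI)
  fix a b assume a: "a \<in> U" and b: "b \<in> U"
    and ab: "\<forall>j q. 1 \<le> j \<and> j \<le> l \<and> q \<in> Q \<longrightarrow> a (cv j q) = b (cv j q)"
  have "eventually (\<lambda>h. g (a(v := a v + h)) = g (b(v := b v + h))) (nhds 0)"
    using eventually_upd[OF U a assms(2)] eventually_upd[OF U b assms(2)]
  proof eventually_elim
    case (elim h)
    have "(a(v := a v + h)) (cv j q) = (b(v := b v + h)) (cv j q)" if "1 \<le> j \<and> j \<le> l \<and> q \<in> Q" for j q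
      using ab that by auto
    then show ?case using assms(1) elim unfolding dep_def by blast
  qed
  then show "pdiff g v a = pdiff g v b" unfolding pdiff_def by (rule deriv_cong_ev) simp
qed

lemma dep_pdiff_zero:
  assumes "dep l g" "l < j" "j \<le> Suc r" "q \<in> Q" "a \<in> U"
  shows "pdiff g (cv j q) a = 0"
proof (rule pdiff_zero[OF U \<open>a \<in> U\<close>])
  show "cv j q \<in> V" using assms by (intro cv_in) auto
  fix h assume h: "a(cv j q := a (cv j q) + h) \<in> U"
  have "(a(cv j q := a (cv j q) + h)) (cv i s) = a (cv i s)" if "1 \<le> i \<and> i \<le> l \<and> s \<in> Q" for i s
    using cv_eq[of i s j q] that assms by auto
  then show "g (a(cv j q := a (cv j q) + h)) = g a" using assms(1,5) h unfolding dep_def by blast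
qed

text \<open>The \<open>l\<close>-th time derivative of the output \<open>cv 1 q\<close> as a function on the phase space: iterated
  Lie derivatives, in which the terms of order above \<open>l\<close> vanish and are left out.\<close>

fun Ly :: "nat \<Rightarrow> 'q \<Rightarrow> ('v \<Rightarrow> real) \<Rightarrow> real" where
  "Ly 0 q a = a (cv 1 q)"
| "Ly (Suc l) q a = (\<Sum>j = 1..Suc l. \<Sum>s\<in>Q. pdiff (Ly l q) (cv j s) a * G j s a)"

text \<open>Each Lie derivative raises the order of dependence by one, because \<open>G j s\<close>
  reaches order \<open>j + 1\<close>. The bound \<open>l \<le> r\<close> ensures that only
  right-hand sides \<open>G j s\<close> with \<open>j \<le> r\<close> occur.\<close>

lemma Ly_smooth_dep:
  assumes "q \<in> Q" "l \<le> r"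
  shows "smooth_on V U (Ly l q) \<and> dep (Suc l) (Ly l q)"
  using assms(2)
proof (induction l)
  case 0
  have "Ly 0 q = (\<lambda>a. a (cv 1 q))" by (simp add: fun_eq_iff)
  then show ?case
    using assms(1) cv_in[of 1 q] by (simp add: smooth_on_def ck_on_coord[OF U] dep_def)
next
  case (Suc l)
  then have IH: "smooth_on V U (Ly l q)" "dep (Suc l) (Ly l q)" by auto
  have Ly: "Ly (Suc l) q = (\<lambda>a. \<Sum>j = 1..Suc l. \<Sum>s\<in>Q. pdiff (Ly l q) (cv j s) a * G j s a)"
    by (simp add: fun_eq_iff)
  have inV: "cv j s \<in> V" if "j \<in> {1..Suc l}" "s \<in> Q" for j s using that Suc.prems by (intro cv_in) auto
  have "smooth_on V U (Ly (Suc l) q)"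
    unfolding Ly smooth_on_def
    by (intro allI ck_on_sum[OF U] ck_on_mult[OF U] smooth_onD[OF smooth_on_pdiff[OF IH(1)]]
        smooth_onD[OF smooth] inV) (use Suc.prems in auto)
  moreover have "dep (Suc (Suc l)) (Ly (Suc l) q)"
    unfolding dep_def Ly
  proof (intro ballI impI sum.cong refl arg_cong2[where f = "(*)"])
    fix a b j s assume ab: "a \<in> U" "b \<in> U"
      "\<forall>j q. 1 \<le> j \<and> j \<le> Suc (Suc l) \<and> q \<in> Q \<longrightarrow> a (cv j q) = b (cv j q)"
      and js: "j \<in> {1..Suc l}" "s \<in> Q"
    show "pdiff (Ly l q) (cv j s) a = pdiff (Ly l q) (cv j s) b"
    proof -
      have "\<forall>j q. 1 \<le> j \<and> j \<le> Suc l \<and> q \<in> Q \<longrightarrow> a (cv j q) = b (cv j q)" using ab(3) by simp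
      then show ?thesis using dep_pdiff[OF IH(2) inV[OF js]] ab(1,2) unfolding dep_def by blast
    qed
    show "G j s a = G j s b"
    proof (rule dep_G[OF _ _ js(2) ab(1,2)])
      show "a (cv i t) = b (cv i t)" if "1 \<le> i" "i \<le> Suc j" "t \<in> Q" for i t
        using ab(3) that js(1) by simp
    qed (use js Suc.prems in auto)
  qed
  ultimately show ?case by blast
qed

lemmas Ly_smooth = Ly_smooth_dep[THEN conjunct1]
lemmas Ly_dep = Ly_smooth_dep[THEN conjunct2]

text \<open>In the product rule the derivatives of \<open>Ly l q\<close>, and \<open>G j t\<close>
  for \<open>j \<le> l\<close>, do not depend on order \<open>l + 2\<close>; only the term with
  \<open>G (l + 1)\<close> survives. So the diagonal block of order \<open>l + 2\<close> is the
  block of order \<open>l + 1\<close> times one Jacobian of the system.\<close>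

lemma pdiff_Ly_Suc:
  assumes q: "q \<in> Q" and l: "Suc l \<le> r" and s: "s \<in> Q"
  shows "pdiff (Ly (Suc l) q) (cv (Suc (Suc l)) s) p =
    (\<Sum>t\<in>Q. pdiff (Ly l q) (cv (Suc l) t) p * pdiff (G (Suc l) t) (cv (Suc (Suc l)) s) p)"
proof -
  define w where "w = cv (Suc (Suc l)) s"
  have wV: "w \<in> V" using l s by (auto simp: w_def intro: cv_in)
  define P where "P j t = pdiff (Ly l q) (cv j t)" for j t
  have sm: "smooth_on V U (Ly l q)" and dp: "dep (Suc l) (Ly l q)" using Ly_smooth Ly_dep q l by auto
  have inV: "cv j t \<in> V" if "j \<in> {1..Suc l}" "t \<in> Q" for j t using that l by (intro cv_in) auto
  have P0: "pdiff (P j t) w p = 0" if "j \<in> {1..Suc l}" "t \<in> Q" for j t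
    unfolding P_def w_def by (rule dep_pdiff_zero[OF dep_pdiff[OF dp inV[OF that]]]) (use l s p in auto)
  have G0: "pdiff (G j t) w p = 0" if "j \<in> {1..l}" "t \<in> Q" for j t
    unfolding w_def
  proof (rule dep_pdiff_zero)
    show "dep (Suc j) (G j t)" unfolding dep_def
      by (intro ballI impI dep_G) (use that l in auto)
  qed (use that l s p in auto)
  have "((\<lambda>h. \<Sum>j = 1..Suc l. \<Sum>t\<in>Q. P j t (p(w := p w + h)) * G j t (p(w := p w + h))) has_real_derivative
      (\<Sum>j = 1..Suc l. \<Sum>t\<in>Q. pdiff (P j t) w p * G j t p + pdiff (G j t) w p * P j t p)) (at 0)"
  proof (intro DERIV_sum)
    fix j t assume jt: "j \<in> {1..Suc l}" "t \<in> Q"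
    have "((\<lambda>h. P j t (p(w := p w + h))) has_real_derivative pdiff (P j t) w p) (at 0)"
      unfolding P_def by (rule ck_on_pderiv[OF smooth_onD[OF smooth_on_pdiff[OF sm inV[OF jt]]] wV p])
    moreover have "((\<lambda>h. G j t (p(w := p w + h))) has_real_derivative pdiff (G j t) w p) (at 0)"
      by (rule ck_on_pderiv[OF smooth_onD[OF smooth] wV p]) (use jt l in auto)
    ultimately show "((\<lambda>h. P j t (p(w := p w + h)) * G j t (p(w := p w + h))) has_real_derivative
      pdiff (P j t) w p * G j t p + pdiff (G j t) w p * P j t p) (at 0)"
      by (rule DERIV_cong[OF DERIV_mult]) simp
  qed
  then have "pdiff (Ly (Suc l) q) w p =
      (\<Sum>j = 1..Suc l. \<Sum>t\<in>Q. pdiff (P j t) w p * G j t p + pdiff (G j t) w p * P j t p)"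
    by (intro pdiff_eqI) (simp only: Ly.simps P_def)
  also have "\<dots> = (\<Sum>j = 1..Suc l. \<Sum>t\<in>Q. pdiff (G j t) w p * P j t p)"
    by (intro sum.cong refl) (simp add: P0)
  also have "\<dots> = (\<Sum>j = 1..l. \<Sum>t\<in>Q. pdiff (G j t) w p * P j t p) + (\<Sum>t\<in>Q. pdiff (G (Suc l) t) w p * P (Suc l) t p)"
    by simp
  also have "(\<Sum>j = 1..l. \<Sum>t\<in>Q. pdiff (G j t) w p * P j t p) = 0"
    by (intro sum.neutral ballI) (simp add: G0)
  finally show ?thesis unfolding w_def P_def by (simp only: add_0_left mult.commute)
qed

text \<open>The diagonal block is a product by \<open>pdiff_Ly_Suc\<close>, and its factors are
  removed one by one: the image \<open>\<zeta>\<close> of \<open>\<eta>\<close> under the rightmost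
  factor vanishes by induction, and then \<open>ker_G\<close> gives
  \<open>\<eta> = 0\<close>.\<close>

lemma ker_Ly_diagonal:
  assumes "l \<le> r" and "\<And>q. q \<in> Q \<Longrightarrow> (\<Sum>s\<in>Q. pdiff (Ly l q) (cv (Suc l) s) p * \<eta> s) = 0" and "s \<in> Q"
  shows "\<eta> s = 0"
  using assms
proof (induction l arbitrary: \<eta> s)
  case 0
  have "pdiff (Ly 0 s) (cv (Suc 0) t) p = (if t = s then 1 else 0)" if "t \<in> Q" for t
  proof (rule pdiff_eqI)
    have "cv 1 s = cv (Suc 0) t \<longleftrightarrow> s = t" using cv_eq[of 1 s "Suc 0" t] that 0 by auto
    then show "((\<lambda>h. Ly 0 s (p(cv (Suc 0) t := p (cv (Suc 0) t) + h))) has_real_derivative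
        (if t = s then 1 else 0)) (at 0)"
      by (auto intro!: derivative_eq_intros)
  qed
  then have "(\<Sum>t\<in>Q. pdiff (Ly 0 s) (cv (Suc 0) t) p * \<eta> t) = (\<Sum>t\<in>Q. if t = s then \<eta> t else 0)"
    by (intro sum.cong) auto
  then show ?case using 0(2)[OF 0(3)] Q 0(3) by simp
next
  case (Suc l)
  define \<zeta> where "\<zeta> t = (\<Sum>s\<in>Q. pdiff (G (Suc l) t) (cv (Suc (Suc l)) s) p * \<eta> s)" for t
  have "\<zeta> t = 0" if "t \<in> Q" for t
  proof (rule Suc.IH[OF _ _ that])
    fix q assume q: "q \<in> Q"
    have "(\<Sum>t\<in>Q. pdiff (Ly l q) (cv (Suc l) t) p * \<zeta> t) =
       (\<Sum>t\<in>Q. \<Sum>s\<in>Q. pdiff (Ly l q) (cv (Suc l) t) p * pdiff (G (Suc l) t) (cv (Suc (Suc l)) s) p * \<eta> s)"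
      by (simp add: \<zeta>_def sum_distrib_left mult.assoc)
    also have "\<dots> = (\<Sum>s\<in>Q. pdiff (Ly (Suc l) q) (cv (Suc (Suc l)) s) p * \<eta> s)"
      by (subst sum.swap) (intro sum.cong refl, simp only: pdiff_Ly_Suc[OF q Suc.prems(1)] sum_distrib_right)
    also have "\<dots> = 0" by (rule Suc.prems(2)[OF q])
    finally show "(\<Sum>t\<in>Q. pdiff (Ly l q) (cv (Suc l) t) p * \<zeta> t) = 0" .
  qed (use Suc.prems in simp)
  then show ?case
    by (intro ker_G[of "Suc l" \<eta> s]) (use Suc.prems in \<open>auto simp: \<zeta>_def\<close>)
qed

text \<open>Forward substitution by order. In the rows of \<open>Ly l\<close> the columns of order
  at most \<open>l\<close> meet components already known to be 0, and those of order above
  \<open>l + 1\<close> have zero entries. What remains is the diagonal block.\<close>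

lemma ker_Ly:
  assumes "\<And>l q. l \<le> r \<Longrightarrow> q \<in> Q \<Longrightarrow> (\<Sum>v\<in>V. pdiff (Ly l q) v p * \<xi> v) = 0" and "v \<in> V"
  shows "\<xi> v = 0"
proof -
  have z: "l \<le> r \<Longrightarrow> s \<in> Q \<Longrightarrow> \<xi> (cv (Suc l) s) = 0" for l s
  proof (induction l arbitrary: s rule: less_induct)
    case (less l)
    show ?case
    proof (rule ker_Ly_diagonal[OF less.prems(1) _ less.prems(2)])
      fix q assume q: "q \<in> Q"
      have "(\<Sum>v\<in>V. pdiff (Ly l q) v p * \<xi> v) =
          (\<Sum>j = 1..Suc r. \<Sum>s\<in>Q. pdiff (Ly l q) (cv j s) p * \<xi> (cv j s))"
        by (rule sum_V)
      also have "\<dots> = (\<Sum>j = 1..Suc r. if j = Suc l then \<Sum>s\<in>Q. pdiff (Ly l q) (cv j s) p * \<xi> (cv j s) else 0)"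
      proof (rule sum.cong[OF refl])
        fix j assume j: "j \<in> {1..Suc r}"
        have "pdiff (Ly l q) (cv j s) p * \<xi> (cv j s) = 0" if "j \<noteq> Suc l" "s \<in> Q" for s
        proof (cases "j < Suc l")
          case True
          then show ?thesis using less.IH[of "j - 1" s] less.prems j that by auto
        next
          case False
          then show ?thesis
            using dep_pdiff_zero[OF Ly_dep[OF q less.prems(1)], of j s p] j that p by auto
        qed
        then show "(\<Sum>s\<in>Q. pdiff (Ly l q) (cv j s) p * \<xi> (cv j s)) =
            (if j = Suc l then \<Sum>s\<in>Q. pdiff (Ly l q) (cv j s) p * \<xi> (cv j s) else 0)"
          by (cases "j = Suc l") (simp_all add: sum.neutral)
      qed
      also have "\<dots> = (\<Sum>s\<in>Q. pdiff (Ly l q) (cv (Suc l) s) p * \<xi> (cv (Suc l) s))"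
        using less.prems by (subst sum.delta) auto
      finally show "(\<Sum>s\<in>Q. pdiff (Ly l q) (cv (Suc l) s) p * \<xi> (cv (Suc l) s)) = 0"
        using assms(1)[OF less.prems(1) q] by simp
    qed
  qed
  obtain j q where "1 \<le> j" "j \<le> Suc r" "q \<in> Q" "v = cv j q"
    using assms(2) by (rule V_cases)
  then show ?thesis using z[of "j - 1" q] by auto
qed

text \<open>The Jacobian of the map to jets is square, since \<open>J\<close> and \<open>V\<close>
  both have \<open>(r + 1) * card Q\<close> elements, and \<open>ker_Ly\<close> makes its kernel at
  \<open>p\<close> trivial. \<open>smooth_matrix_inverse\<close> then supplies the setting of
  \<open>local_diffeo\<close>.\<close>

theorem local_inversion:
  obtains X W \<Phi> where "opn V X" "p \<in> X" "X \<subseteq> U" "opn (jetvars r Q) W"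
    "\<And>v. v \<in> V \<Longrightarrow> smooth_on (jetvars r Q) W (\<lambda>w. \<Phi> w v)"
    "\<And>a. a \<in> X \<Longrightarrow> (\<lambda>(l, q). if l \<le> r \<and> q \<in> Q then Ly l q a else 0) \<in> W"
    "\<And>a. a \<in> X \<Longrightarrow> \<Phi> (\<lambda>(l, q). if l \<le> r \<and> q \<in> Q then Ly l q a else 0) = a"
proof -
  define J where "J = jetvars r Q"
  define f where "f = (\<lambda>(l, q). Ly l q)"
  have J_eq: "J = {..r} \<times> Q" by (auto simp: J_def jetvars_def)
  have J: "finite J" using Q by (simp add: J_eq)
  have card: "card J = card V"
    using bij_betw_same_card[OF cv] Q by (simp add: J_eq card_cartesian_product)
  have f: "smooth_on V U (f j)" if "j \<in> J" for j
    using that Ly_smooth by (auto simp: f_def J_eq)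
  obtain S B where S: "opn V S" "p \<in> S" "S \<subseteq> U"
    and B: "\<And>v j. v \<in> V \<Longrightarrow> j \<in> J \<Longrightarrow> smooth_on V S (\<lambda>a. B a v j)"
    "\<And>a v v'. a \<in> S \<Longrightarrow> v \<in> V \<Longrightarrow> v' \<in> V \<Longrightarrow>
      (\<Sum>j\<in>J. B a v j * pdiff (f j) v' a) = (if v = v' then 1 else 0)"
    "\<And>a j j'. a \<in> S \<Longrightarrow> j \<in> J \<Longrightarrow> j' \<in> J \<Longrightarrow>
      (\<Sum>v\<in>V. pdiff (f j) v a * B a v j') = (if j = j' then 1 else 0)"
  proof (rule smooth_matrix_inverse[OF finite_V J card U p, of "\<lambda>a j v. pdiff (f j) v a"])
    show "smooth_on V U (\<lambda>a. pdiff (f j) v a)" if "j \<in> J" "v \<in> V" for j v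
      using smooth_on_pdiff[OF f[OF that(1)] that(2)] .
    show "\<xi> v = 0" if \<xi>: "\<And>j. j \<in> J \<Longrightarrow> (\<Sum>v\<in>V. pdiff (f j) v p * \<xi> v) = 0" and "v \<in> V" for \<xi> v
    proof (rule ker_Ly[OF _ \<open>v \<in> V\<close>])
      show "(\<Sum>v\<in>V. pdiff (Ly l q) v p * \<xi> v) = 0" if lq: "l \<le> r" "q \<in> Q" for l q
        using \<xi>[of "(l, q)"] lq by (simp add: f_def J_eq)
    qed
  qed blast
  interpret D: local_diffeo V J S p f B
    by (rule local_diffeo.intro[OF finite_V J S(1,2) smooth_on_subset[OF f S(3)] B])
  obtain e W \<Phi> where e: "e > 0" "bx V p e \<subseteq> S" "opn J W"
    "\<And>v. v \<in> V \<Longrightarrow> smooth_on J W (\<lambda>w. \<Phi> w v)"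
    "\<And>a. a \<in> bx V p e \<Longrightarrow> D.F a \<in> W" "\<And>a. a \<in> bx V p e \<Longrightarrow> \<Phi> (D.F a) = a"
    by (rule D.inverse_function) blast
  have F: "D.F a = (\<lambda>(l, q). if l \<le> r \<and> q \<in> Q then Ly l q a else 0)" for a
    unfolding fun_eq_iff D.F_def by (auto simp: f_def J_eq)
  show thesis
  proof (rule that[of "bx V p e" W \<Phi>])
    show "p \<in> bx V p e" using opn_ptsD[OF U p] e(1) by (rule bx_self)
  qed (use opn_bx[OF finite_V] e[unfolded F, unfolded J_def] S(3) in auto)
qed

text \<open>Induction by the chain rule. For \<open>l < r\<close> the function \<open>Ly l q\<close>
  depends on orders at most \<open>r\<close>, so the derivative of the input enters with coefficient
  0.\<close>

lemma deriv_output: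
  assumes T: "open T" and cU: "\<And>t. t \<in> T \<Longrightarrow> c t \<in> U"
    and dyn: "\<And>t j q. t \<in> T \<Longrightarrow> 1 \<le> j \<Longrightarrow> j \<le> r \<Longrightarrow> q \<in> Q \<Longrightarrow>
      ((\<lambda>s. c s (cv j q)) has_real_derivative G j q (c t)) (at t)"
    and inp: "\<And>t q. t \<in> T \<Longrightarrow> q \<in> Q \<Longrightarrow> (\<lambda>s. c s (cv (Suc r) q)) field_differentiable (at t)"
    and q: "q \<in> Q" and "l \<le> r" "t \<in> T"
  shows "(deriv ^^ l) (\<lambda>s. c s (cv 1 q)) t = Ly l q (c t)"
  using \<open>l \<le> r\<close> \<open>t \<in> T\<close>
proof (induction l arbitrary: t)
  case 0
  then show ?case by simp
next
  case (Suc l)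
  have ev: "eventually (\<lambda>s. s \<in> T) (nhds t)" using T Suc.prems(2) by (rule eventually_nhds_in_open)
  have "(deriv ^^ Suc l) (\<lambda>s. c s (cv 1 q)) t = deriv (\<lambda>s. Ly l q (c s)) t"
    unfolding funpow.simps comp_def
  proof (rule deriv_cong_ev)
    show "eventually (\<lambda>s. (deriv ^^ l) (\<lambda>s. c s (cv 1 q)) s = Ly l q (c s)) (nhds t)"
      using ev by eventually_elim (use Suc in auto)
  qed simp
  also have "\<dots> = Ly (Suc l) q (c t)"
  proof (rule DERIV_imp_deriv)
    \<comment> \<open>The velocity is given by \<open>deriv\<close>, as the system provides no
      formula for the input coordinates.\<close>
    define c' where "c' v = deriv (\<lambda>s. c s v) t" for v
    have c': "((\<lambda>s. c s v) has_real_derivative c' v) (at t)" if v: "v \<in> V" for v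
    proof -
      obtain j s where js: "1 \<le> j" "j \<le> Suc r" "s \<in> Q" "v = cv j s"
        using v by (rule V_cases)
      have "(\<lambda>s. c s v) field_differentiable (at t)"
        using dyn[OF Suc.prems(2) js(1) _ js(3)] inp[OF Suc.prems(2) js(3)] js(2,4)
        by (cases "j = Suc r") (auto simp: field_differentiable_def)
      then show ?thesis by (simp add: c'_def DERIV_deriv_iff_field_differentiable)
    qed
    have "((\<lambda>s. Ly l q (c s)) has_real_derivative (\<Sum>v\<in>V. pdiff (Ly l q) v (c t) * c' v)) (at t)"
    proof (rule chain_rule[OF finite_V U _ cU[OF Suc.prems(2)] _ c'])
      show "ck_on (Suc 0) V U (Ly l q)" by (rule smooth_onD[OF Ly_smooth[OF q]]) (use Suc.prems in simp)
      show "eventually (\<lambda>s. c s \<in> U) (at t)"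
        using ev unfolding eventually_at_filter by eventually_elim (simp add: cU)
    qed
    moreover have "(\<Sum>v\<in>V. pdiff (Ly l q) v (c t) * c' v) = Ly (Suc l) q (c t)"
    proof -
      have "(\<Sum>v\<in>V. pdiff (Ly l q) v (c t) * c' v) =
          (\<Sum>j = 1..Suc r. \<Sum>s\<in>Q. pdiff (Ly l q) (cv j s) (c t) * c' (cv j s))" by (rule sum_V)
      also have "\<dots> = (\<Sum>j = 1..Suc l. \<Sum>s\<in>Q. pdiff (Ly l q) (cv j s) (c t) * c' (cv j s))"
      proof (rule sum.mono_neutral_right)
        show "\<forall>j\<in>{1..Suc r} - {1..Suc l}. (\<Sum>s\<in>Q. pdiff (Ly l q) (cv j s) (c t) * c' (cv j s)) = 0"
        proof (intro ballI sum.neutral)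
          fix j s assume "j \<in> {1..Suc r} - {1..Suc l}" "s \<in> Q"
          then show "pdiff (Ly l q) (cv j s) (c t) * c' (cv j s) = 0"
            using dep_pdiff_zero[OF Ly_dep[OF q], of l j s "c t"] Suc.prems cU by auto
        qed
      qed (use Suc.prems in auto)
      also have "\<dots> = Ly (Suc l) q (c t)"
        unfolding Ly.simps
      proof (intro sum.cong refl arg_cong2[where f = "(*)"])
        fix j s assume "j \<in> {1..Suc l}" "s \<in> Q"
        then show "c' (cv j s) = G j s (c t)"
          unfolding c'_def by (intro DERIV_imp_deriv dyn) (use Suc.prems in auto)
      qed
      finally show ?thesis .
    qed
    ultimately show "((\<lambda>s. Ly l q (c s)) has_real_derivative Ly (Suc l) q (c t)) (at t)" by simp
  qed
  finally show ?case .
qed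

end

section \<open>Coupled pure-feedback systems\<close>

text \<open>\<open>q\<close> is a pair of subsystem and component. Substates of every order have the
  dimension of the input, so the one index set \<open>IV N m\<close> serves all orders.\<close>

definition cvar :: "nat \<Rightarrow> nat \<Rightarrow> nat \<times> nat \<Rightarrow> nat \<times> nat \<times> nat + nat \<times> nat" where
  "cvar r j q = (if j \<le> r then Inl (fst q, j, snd q) else Inr q)"

lemma cvar_eq: "i \<le> Suc r \<Longrightarrow> j \<le> Suc r \<Longrightarrow> cvar r i q = cvar r j s \<longleftrightarrow> i = j \<and> q = s"
  by (auto simp: cvar_def prod_eq_iff)

lemma finite_IV: "finite (IV N m)"
proof -
  have "IV N m = (SIGMA i:{..<N}. {..<m i})" by (auto simp: IV_def)
  then show ?thesis by simp
qed

lemma cvar_bij: "bij_betw (\<lambda>(j, q). cvar r j q) ({1..Suc r} \<times> IV N m) (SV N r m <+> IV N m)"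
proof (rule bij_betwI')
  fix x y assume "x \<in> {1..Suc r} \<times> IV N m" "y \<in> {1..Suc r} \<times> IV N m"
  then show "((case x of (j, q) \<Rightarrow> cvar r j q) = (case y of (j, q) \<Rightarrow> cvar r j q)) = (x = y)"
    by (cases x; cases y) (simp add: cvar_eq)
next
  fix x assume "x \<in> {1..Suc r} \<times> IV N m"
  then show "(case x of (j, q) \<Rightarrow> cvar r j q) \<in> SV N r m <+> IV N m"
    by (auto simp: cvar_def SV_def IV_def)
next
  fix v assume "v \<in> SV N r m <+> IV N m"
  then consider i j k where "v = Inl (i, j, k)" "(i, j, k) \<in> SV N r m" | q where "v = Inr q" "q \<in> IV N m"
    by (auto simp: Plus_def)
  then show "\<exists>x\<in>{1..Suc r} \<times> IV N m. v = (case x of (j, q) \<Rightarrow> cvar r j q)"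
  proof cases
    case (1 i j k)
    then show ?thesis by (intro bexI[of _ "(j, (i, k))"]) (auto simp: cvar_def SV_def IV_def)
  next
    case (2 q)
    then show ?thesis by (intro bexI[of _ "(Suc r, q)"]) (auto simp: cvar_def)
  qed
qed

lemma finite_SV: "finite (SV N r m)"
proof -
  have "finite (SV N r m <+> IV N m)"
    using bij_betw_finite[OF cvar_bij, of r N m] finite_IV by simp
  then show ?thesis by simp
qed

lemma smooth_on_state_function:
  assumes "smooth_on A (pts A) g" "finite A" "opn (A <+> B) U"
  shows "smooth_on (A <+> B) U (\<lambda>z. g (z \<circ> Inl))"
  unfolding smooth_on_def
proof
  fix n
  show "ck_on n (A <+> B) U (\<lambda>z. g (z \<circ> Inl))"
  proof (rule ck_on_compose[OF assms(2) opn_pts assms(3) smooth_onD[OF assms(1)]])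
    show "z \<circ> Inl \<in> pts A" if "z \<in> U" for z
      using opn_ptsD[OF assms(3) that] by (auto simp: pts_def)
    show "ck_on n (A <+> B) U (\<lambda>w. (w \<circ> Inl) v)" if "v \<in> A" for v
      using ck_on_coord[OF assms(3) InlI[OF that]] by simp
  qed
qed

text \<open>\<open>U\<close> is a single neighbourhood on which all components of the uncoupled
  dynamics are smooth and the coupling is lower triangular.\<close>

locale coupled_system =
  fixes N r :: nat and m :: "nat \<Rightarrow> nat"
    and fbar :: "nat \<Rightarrow> nat \<Rightarrow> nat \<Rightarrow> (nat \<times> nat \<times> nat \<Rightarrow> real) \<Rightarrow> (nat \<times> nat \<Rightarrow> real) \<Rightarrow> real"
    and \<Delta> :: "nat \<Rightarrow> nat \<Rightarrow> nat \<Rightarrow> (nat \<times> nat \<times> nat \<Rightarrow> real) \<Rightarrow> real"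
    and xs :: "nat \<times> nat \<times> nat \<Rightarrow> real" and us :: "nat \<times> nat \<Rightarrow> real"
    and U :: "(nat \<times> nat \<times> nat + nat \<times> nat \<Rightarrow> real) set"
  assumes r: "r \<ge> 1"
    and pf: "pure_feedback N r m fbar"
    and reg: "regular N r m fbar xs us"
    and U: "opn (SV N r m <+> IV N m) U" and pU: "xu xs us \<in> U"
    and fbar_smooth: "\<And>i j k. i < N \<Longrightarrow> 1 \<le> j \<Longrightarrow> j \<le> r \<Longrightarrow> k < m i \<Longrightarrow>
      smooth_on (SV N r m <+> IV N m) U (\<lambda>z. fbar i j k (z \<circ> Inl) (z \<circ> Inr))"
    and lt: "lower_triangular N r m \<Delta> U"
begin

abbreviation "V \<equiv> SV N r m <+> IV N m"
abbreviation "p \<equiv> xu xs us"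

section \<open>Dependence and partial derivatives of the uncoupled dynamics and the coupling\<close>

definition fb :: "nat \<Rightarrow> nat \<times> nat \<Rightarrow> (nat \<times> nat \<times> nat + nat \<times> nat \<Rightarrow> real) \<Rightarrow> real" where
  "fb j q z = fbar (fst q) j (snd q) (z \<circ> Inl) (z \<circ> Inr)"

definition dl :: "nat \<Rightarrow> nat \<times> nat \<Rightarrow> (nat \<times> nat \<times> nat + nat \<times> nat \<Rightarrow> real) \<Rightarrow> real" where
  "dl j q z = \<Delta> (fst q) j (snd q) (z \<circ> Inl)"

lemma fb_smooth: "1 \<le> j \<Longrightarrow> j \<le> r \<Longrightarrow> q \<in> IV N m \<Longrightarrow> smooth_on V U (fb j q)"
  using fbar_smooth[of "fst q" j "snd q"] unfolding fb_def[abs_def] by (auto simp: IV_def)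

lemma dl_smooth: "1 \<le> j \<Longrightarrow> j \<le> r \<Longrightarrow> q \<in> IV N m \<Longrightarrow> smooth_on V U (dl j q)"
  unfolding dl_def[abs_def]
  by (rule smooth_on_state_function[OF _ finite_SV U]) (use lt in \<open>auto simp: lower_triangular_def IV_def\<close>)

text \<open>For \<open>j = r\<close> the order \<open>j + 1\<close> is the input, which merges the
  two clauses of \<open>pure_feedback\<close> into one statement.\<close>

lemma fb_dep:
  assumes j: "1 \<le> j" "j \<le> r" and q: "q \<in> IV N m"
    and ab: "\<And>i k. 1 \<le> i \<Longrightarrow> i \<le> Suc j \<Longrightarrow> k < m (fst q) \<Longrightarrow> a (cvar r i (fst q, k)) = b (cvar r i (fst q, k))"
  shows "fb j q a = fb j q b"
proof -
  obtain i k where q_eq: "q = (i, k)" by (cases q)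
  have ik: "i < N" "k < m i" using q by (auto simp: q_eq IV_def)
  show ?thesis
  proof (cases "j < r")
    case True
    let ?R = "restr {(i', j', l). i' = i \<and> 1 \<le> j' \<and> j' \<le> j + 1 \<and> l < m i}"
    have pf': "fbar i j k x u = fbar i j k (?R x) (restr {} u)" for x u
      using pf ik True j(1) unfolding pure_feedback_def by blast
    have 1: "?R (a \<circ> Inl) = ?R (b \<circ> Inl)"
    proof
      fix v
      show "?R (a \<circ> Inl) v = ?R (b \<circ> Inl) v"
        using ab[of "fst (snd v)" "snd (snd v)"] True
        by (cases v) (auto simp: restr_def cvar_def q_eq)
    qed
    show ?thesis unfolding fb_def q_eq fst_conv snd_conv
      by (subst (1 2) pf') (simp only: 1 restr_def[of "{}"] empty_iff if_False)
  next
    case False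
    then have jr: "j = r" using j by simp
    let ?R = "restr {(i', j', l). i' = i \<and> 1 \<le> j' \<and> j' \<le> r \<and> l < m i}"
    let ?I = "restr {(i', l). i' = i \<and> l < m i}"
    have pf': "fbar i r k x u = fbar i r k (?R x) (?I u)" for x u
      using pf ik unfolding pure_feedback_def by blast
    have 1: "?R (a \<circ> Inl) = ?R (b \<circ> Inl)"
    proof
      fix v
      show "?R (a \<circ> Inl) v = ?R (b \<circ> Inl) v"
        using ab[of "fst (snd v)" "snd (snd v)"] jr
        by (cases v) (auto simp: restr_def cvar_def q_eq)
    qed
    have 2: "?I (a \<circ> Inr) = ?I (b \<circ> Inr)"
    proof
      fix v
      show "?I (a \<circ> Inr) v = ?I (b \<circ> Inr) v"
        using ab[of "Suc r" "snd v"] jr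
        by (cases v) (auto simp: restr_def cvar_def q_eq)
    qed
    show ?thesis unfolding fb_def q_eq fst_conv snd_conv jr
      by (subst (1 2) pf') (simp only: 1 2)
  qed
qed

lemma dl_dep:
  assumes j: "1 \<le> j" "j \<le> r" and q: "q \<in> IV N m" and a: "a \<in> U" and b: "b \<in> U"
    and ab: "\<And>i s. s \<in> IV N m \<Longrightarrow> 1 \<le> i \<Longrightarrow> i \<le> j \<or> (i = Suc j \<and> Suc j \<le> r \<and> fst s < fst q) \<Longrightarrow>
      a (cvar r i s) = b (cvar r i s)"
  shows "dl j q a = dl j q b"
proof -
  obtain i k where q_eq: "q = (i, k)" by (cases q)
  have ik: "i < N" "k < m i" using q by (auto simp: q_eq IV_def)
  obtain \<Delta>bar where "\<forall>i<N. \<forall>j. 1 \<le> j \<and> j \<le> r \<longrightarrow> (\<forall>k<m i. \<forall>z\<in>U.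
         \<Delta> i j k (z \<circ> Inl) = \<Delta>bar i j k (restr (LTvars N r m i j) (z \<circ> Inl)))"
    using lt unfolding lower_triangular_def by blast
  then have D: "\<Delta> i j k (z \<circ> Inl) = \<Delta>bar i j k (restr (LTvars N r m i j) (z \<circ> Inl))" if "z \<in> U" for z
    using ik j that by blast
  have "restr (LTvars N r m i j) (a \<circ> Inl) = restr (LTvars N r m i j) (b \<circ> Inl)"
  proof
    fix v
    show "restr (LTvars N r m i j) (a \<circ> Inl) v = restr (LTvars N r m i j) (b \<circ> Inl) v"
      using ab[of "(fst v, snd (snd v))" "fst (snd v)"] j
      by (cases v) (auto simp: restr_def cvar_def q_eq IV_def LTvars_def)
  qed
  then show ?thesis by (simp add: dl_def q_eq D a b)
qed

lemma pdiff_sum: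
  assumes "1 \<le> j" "j \<le> r" "q \<in> IV N m" "v \<in> V"
  shows "pdiff (\<lambda>z. fb j q z + dl j q z) v p = pdiff (fb j q) v p + pdiff (dl j q) v p"
  by (rule pdiff_eqI)
     (intro DERIV_add ck_on_pderiv[OF smooth_onD[OF fb_smooth[OF assms(1-3)]] assms(4) pU]
        ck_on_pderiv[OF smooth_onD[OF dl_smooth[OF assms(1-3)]] assms(4) pU])

lemma cvar_in: "1 \<le> j \<Longrightarrow> j \<le> Suc r \<Longrightarrow> q \<in> IV N m \<Longrightarrow> cvar r j q \<in> V"
  using bij_betwE[OF cvar_bij, of r N m] by auto

lemma pdiff_fb_zero:
  assumes j: "1 \<le> j" "j \<le> r" and q: "q \<in> IV N m" and s: "s \<in> IV N m" "fst s \<noteq> fst q"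
  shows "pdiff (fb j q) (cvar r (Suc j) s) p = 0"
proof (rule pdiff_zero[OF U pU])
  show "cvar r (Suc j) s \<in> V" using j s by (intro cvar_in) auto
  show "fb j q (p(cvar r (Suc j) s := p (cvar r (Suc j) s) + h)) = fb j q p" for h
  proof (rule fb_dep[OF j q])
    fix i k assume "1 \<le> i" "i \<le> Suc j"
    then have "cvar r i (fst q, k) \<noteq> cvar r (Suc j) s" using cvar_eq[of i r "Suc j" "(fst q, k)" s] j s(2) by auto
    then show "(p(cvar r (Suc j) s := p (cvar r (Suc j) s) + h)) (cvar r i (fst q, k)) = p (cvar r i (fst q, k))"
      by simp
  qed
qed

text \<open>Of order \<open>j + 1\<close> the coupling sees only subsystems strictly below that of
  \<open>q\<close>. For \<open>j = r\<close> the coordinate is an input, on which the coupling does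
  not depend.\<close>

lemma pdiff_dl_zero:
  assumes j: "1 \<le> j" "j \<le> r" and q: "q \<in> IV N m" and s: "s \<in> IV N m" "fst q \<le> fst s"
  shows "pdiff (dl j q) (cvar r (Suc j) s) p = 0"
proof (rule pdiff_zero[OF U pU])
  show "cvar r (Suc j) s \<in> V" using j s by (intro cvar_in) auto
  show "dl j q (p(cvar r (Suc j) s := p (cvar r (Suc j) s) + h)) = dl j q p"
    if "p(cvar r (Suc j) s := p (cvar r (Suc j) s) + h) \<in> U" for h
  proof (rule dl_dep[OF j q that pU])
    fix i t assume "t \<in> IV N m" "1 \<le> i" "i \<le> j \<or> (i = Suc j \<and> Suc j \<le> r \<and> fst t < fst q)"
    then have "cvar r i t \<noteq> cvar r (Suc j) s" using cvar_eq[of i r "Suc j" t s] j s(2) by auto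
    then show "(p(cvar r (Suc j) s := p (cvar r (Suc j) s) + h)) (cvar r i t) = p (cvar r i t)" by simp
  qed
qed

text \<open>The matrix is block lower triangular in the subsystem index, with the regular uncoupled
  Jacobians on the diagonal.\<close>

lemma coupled_ker:
  assumes j: "1 \<le> j" "j \<le> r"
    and \<eta>: "\<And>q. q \<in> IV N m \<Longrightarrow>
      (\<Sum>s\<in>IV N m. pdiff (\<lambda>z. fb j q z + dl j q z) (cvar r (Suc j) s) p * \<eta> s) = 0"
  shows "i < N \<Longrightarrow> l < m i \<Longrightarrow> \<eta> (i, l) = 0"
proof (induction i arbitrary: l rule: less_induct)
  case (less i)
  let ?M = "mat (m i) (m i) (\<lambda>(k, l). pdiff (fb j (i, k)) (cvar r (Suc j) (i, l)) p)"
  have det: "det ?M \<noteq> 0"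
  proof (cases "j < r")
    case True
    have "det (mat (m i) (m i) (\<lambda>(k, l).
           pdiff (\<lambda>z. fbar i j k (z \<circ> Inl) (z \<circ> Inr)) (Inl (i, j + 1, l)) (xu xs us))) \<noteq> 0"
      using reg less.prems(1) True j unfolding regular_def by blast
    then show ?thesis using True by (simp add: fb_def[abs_def] cvar_def)
  next
    case False
    then have jr: "j = r" using j by simp
    have "det (mat (m i) (m i) (\<lambda>(k, l).
           pdiff (\<lambda>z. fbar i r k (z \<circ> Inl) (z \<circ> Inr)) (Inr (i, l)) (xu xs us))) \<noteq> 0"
      using reg less.prems(1) unfolding regular_def by blast
    then show ?thesis by (simp add: fb_def[abs_def] cvar_def jr)
  qed
  have "(\<Sum>l<m i. pdiff (fb j (i, k)) (cvar r (Suc j) (i, l)) p * \<eta> (i, l)) = 0" if k: "k < m i" for k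
  proof -
    have q: "(i, k) \<in> IV N m" using k less.prems by (simp add: IV_def)
    have "0 = (\<Sum>s\<in>IV N m. pdiff (\<lambda>z. fb j (i, k) z + dl j (i, k) z) (cvar r (Suc j) s) p * \<eta> s)"
      using \<eta>[OF q] by simp
    \<comment> \<open>Columns of subsystems below \<open>i\<close> vanish because
      \<open>\<eta>\<close> does so by induction, those above \<open>i\<close> because neither
      summand depends on these coordinates. In subsystem \<open>i\<close> itself only
      \<open>fb\<close> contributes.\<close>
    also have "\<dots> = (\<Sum>s\<in>(\<lambda>l. (i, l)) ` {..<m i}. pdiff (fb j (i, k)) (cvar r (Suc j) s) p * \<eta> s)"
    proof (rule sum.mono_neutral_cong_right[OF finite_IV])
      show "(\<lambda>l. (i, l)) ` {..<m i} \<subseteq> IV N m" using less.prems by (auto simp: IV_def)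
      show "\<forall>s\<in>IV N m - (\<lambda>l. (i, l)) ` {..<m i}.
          pdiff (\<lambda>z. fb j (i, k) z + dl j (i, k) z) (cvar r (Suc j) s) p * \<eta> s = 0"
      proof
        fix s assume "s \<in> IV N m - (\<lambda>l. (i, l)) ` {..<m i}"
        then have s: "s \<in> IV N m" "fst s \<noteq> i" by (auto simp: IV_def)
        have V: "cvar r (Suc j) s \<in> V" using j s by (intro cvar_in) auto
        show "pdiff (\<lambda>z. fb j (i, k) z + dl j (i, k) z) (cvar r (Suc j) s) p * \<eta> s = 0"
        proof (cases "fst s < i")
          case True
          then show ?thesis using less.IH[of "fst s" "snd s"] s(1) by (auto simp: IV_def)
        next
          case False
          then show ?thesis
            using pdiff_sum[OF j q V] pdiff_fb_zero[OF j q s(1)] pdiff_dl_zero[OF j q s(1)] s(2) by simp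
        qed
      qed
      fix s assume "s \<in> (\<lambda>l. (i, l)) ` {..<m i}"
      then have s: "s \<in> IV N m" "fst s = i" using less.prems by (auto simp: IV_def)
      have V: "cvar r (Suc j) s \<in> V" using j s by (intro cvar_in) auto
      show "pdiff (\<lambda>z. fb j (i, k) z + dl j (i, k) z) (cvar r (Suc j) s) p * \<eta> s =
          pdiff (fb j (i, k)) (cvar r (Suc j) s) p * \<eta> s"
        using pdiff_sum[OF j q V] pdiff_dl_zero[OF j q s(1)] s(2) by simp
    qed
    also have "\<dots> = (\<Sum>l<m i. pdiff (fb j (i, k)) (cvar r (Suc j) (i, l)) p * \<eta> (i, l))"
      by (subst sum.reindex) (auto simp: inj_on_def)
    finally show ?thesis by simp
  qed
  then show ?case
    using det[unfolded det_nonzero_iff_trivial_kernel, rule_format, of "\<lambda>l. \<eta> (i, l)"] less.prems(2) by blast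
qed

text \<open>Dependence uses triangularity in the order alone; the triangularity among subsystems
  enters through the kernel condition, by \<open>coupled_ker\<close>.\<close>

sublocale triangular_system r "IV N m" "cvar r" V U p "\<lambda>j q z. fb j q z + dl j q z"
proof (rule triangular_system.intro[OF finite_IV cvar_bij U pU])
  fix j q assume j: "1 \<le> j" "j \<le> r"
  show "smooth_on V U (\<lambda>z. fb j q z + dl j q z)" if q: "q \<in> IV N m" for q
    using fb_smooth[OF j q] dl_smooth[OF j q] unfolding smooth_on_def by (intro allI ck_on_add[OF U]) auto
  show "fb j q a + dl j q a = fb j q b + dl j q b"
    if q: "q \<in> IV N m" and a: "a \<in> U" and b: "b \<in> U"
      and ab: "\<And>i s. 1 \<le> i \<Longrightarrow> i \<le> Suc j \<Longrightarrow> s \<in> IV N m \<Longrightarrow> a (cvar r i s) = b (cvar r i s)" for q a b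
  proof -
    have "fb j q a = fb j q b" by (rule fb_dep[OF j q]) (use ab q in \<open>auto simp: IV_def\<close>)
    moreover have "dl j q a = dl j q b" by (rule dl_dep[OF j q a b]) (use ab in auto)
    ultimately show ?thesis by simp
  qed
  show "\<eta> s = 0"
    if \<eta>: "\<And>q. q \<in> IV N m \<Longrightarrow>
      (\<Sum>s\<in>IV N m. pdiff (\<lambda>z. fb j q z + dl j q z) (cvar r (Suc j) s) p * \<eta> s) = 0" and s: "s \<in> IV N m" for \<eta> s
    using coupled_ker[OF j, of \<eta> "fst s" "snd s", OF \<eta>] s by (auto simp: IV_def)
qed

section \<open>Jets along trajectories and flatness\<close>

lemma jet_trajectory:
  assumes traj: "trajectory (SV N r m) (IV N m) (coupled_dyn fbar \<Delta>) X T x u" and X: "X \<subseteq> U" and t: "t \<in> T"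
  shows "jet r (IV N m) (\<lambda>s. first_substates N m (x s) (u s)) t =
    (\<lambda>(l, q). if l \<le> r \<and> q \<in> IV N m then Ly l q (xu (x t) (u t)) else 0)"
proof -
  define c where "c s = xu (x s) (u s)" for s
  have D: "(deriv ^^ l) (\<lambda>s. c s (cvar r 1 q)) t = Ly l q (c t)" if l: "l \<le> r" and q: "q \<in> IV N m" for l q
  proof (rule deriv_output[OF _ _ _ _ q l t])
    show "open T" using traj by (simp add: trajectory_def)
    show "c t \<in> U" if "t \<in> T" for t using traj X that by (auto simp: trajectory_def c_def)
    show "((\<lambda>s. c s (cvar r j q)) has_real_derivative fb j q (c t) + dl j q (c t)) (at t)"
      if "t \<in> T" "1 \<le> j" "j \<le> r" "q \<in> IV N m" for t j q
    proof -
      have "(fst q, j, snd q) \<in> SV N r m" using that by (auto simp: SV_def IV_def)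
      then have "((\<lambda>s. x s (fst q, j, snd q)) has_real_derivative
          coupled_dyn fbar \<Delta> (x t) (u t) (fst q, j, snd q)) (at t)"
        using traj that(1) by (simp add: trajectory_def)
      then show ?thesis
        using that by (simp add: c_def xu_def cvar_def coupled_dyn_def fb_def dl_def comp_def)
    qed
    show "(\<lambda>s. c s (cvar r (Suc r) q)) field_differentiable (at t)" if "t \<in> T" "q \<in> IV N m" for t q
    proof -
      have "smooth_time T (\<lambda>s. u s q)" using traj that(2) by (simp add: trajectory_def)
      then have "((deriv ^^ 0) (\<lambda>s. u s q)) field_differentiable (at t)"
        using that(1) unfolding smooth_time_def by blast
      then show ?thesis by (simp add: c_def xu_def cvar_def)
    qed
  qed
  have out: "(\<lambda>s. first_substates N m (x s) (u s) q) = (\<lambda>s. c s (cvar r 1 q))" if "q \<in> IV N m" for q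
    using that r by (auto simp: first_substates_def c_def xu_def cvar_def IV_def fun_eq_iff)
  show ?thesis
    unfolding jet_def fun_eq_iff c_def[symmetric] using D out by auto
qed

text \<open>Along a trajectory the jet of the output is the image of \<open>(x, u)\<close> under the
  map inverted by \<open>local_inversion\<close>. The state and input coordinates of that inverse
  are the two maps of flatness.\<close>

theorem coupled_flat:
  "\<exists>X. opn V X \<and> p \<in> X \<and>
     diff_flat_on (SV N r m) (IV N m) (IV N m) (coupled_dyn fbar \<Delta>) X (first_substates N m)"
proof -
  obtain X W \<Phi> where X: "opn V X" "p \<in> X" "X \<subseteq> U" and W: "opn (jetvars r (IV N m)) W"
    and \<Phi>: "\<And>v. v \<in> V \<Longrightarrow> smooth_on (jetvars r (IV N m)) W (\<lambda>w. \<Phi> w v)"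
    and inv: "\<And>a. a \<in> X \<Longrightarrow> (\<lambda>(l, q). if l \<le> r \<and> q \<in> IV N m then Ly l q a else 0) \<in> W"
    "\<And>a. a \<in> X \<Longrightarrow> \<Phi> (\<lambda>(l, q). if l \<le> r \<and> q \<in> IV N m then Ly l q a else 0) = a"
    by (rule local_inversion) blast
  have out: "smooth_on V X (\<lambda>z. first_substates N m (z \<circ> Inl) (z \<circ> Inr) q)" if q: "q \<in> IV N m" for q
  proof -
    have "(\<lambda>z. first_substates N m (z \<circ> Inl) (z \<circ> Inr) q) = (\<lambda>z. z (Inl (fst q, 1, snd q)))"
      using q by (auto simp: first_substates_def IV_def fun_eq_iff)
    moreover have "Inl (fst q, 1, snd q) \<in> V" using q r by (auto simp: SV_def IV_def)
    ultimately show ?thesis by (simp add: smooth_on_def ck_on_coord[OF X(1)])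
  qed
  have traj: "jet r (IV N m) (\<lambda>s. first_substates N m (x s) (u s)) t \<in> W \<and>
      (\<forall>v\<in>SV N r m. x t v = \<Phi> (jet r (IV N m) (\<lambda>s. first_substates N m (x s) (u s)) t) (Inl v)) \<and>
      (\<forall>v\<in>IV N m. u t v = \<Phi> (jet r (IV N m) (\<lambda>s. first_substates N m (x s) (u s)) t) (Inr v))"
    if T: "trajectory (SV N r m) (IV N m) (coupled_dyn fbar \<Delta>) X T x u" and t: "t \<in> T" for T x u t
  proof -
    have "xu (x t) (u t) \<in> X" using T t by (simp add: trajectory_def)
    then show ?thesis
      unfolding jet_trajectory[OF T X(3) t] using inv by (simp add: xu_def)
  qed
  show ?thesis
    unfolding diff_flat_on_def
  proof (intro exI[of _ X] conjI X ballI out)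
    show "\<exists>\<beta> \<Phi> \<Psi> W. opn (jetvars \<beta> (IV N m)) W \<and>
        (\<forall>v\<in>SV N r m. smooth_on (jetvars \<beta> (IV N m)) W (\<lambda>w. \<Phi> w v)) \<and>
        (\<forall>v\<in>IV N m. smooth_on (jetvars \<beta> (IV N m)) W (\<lambda>w. \<Psi> w v)) \<and>
        (\<forall>T x u. trajectory (SV N r m) (IV N m) (coupled_dyn fbar \<Delta>) X T x u \<longrightarrow>
           (\<forall>t\<in>T. jet \<beta> (IV N m) (\<lambda>s. first_substates N m (x s) (u s)) t \<in> W \<and>
              (\<forall>v\<in>SV N r m. x t v = \<Phi> (jet \<beta> (IV N m) (\<lambda>s. first_substates N m (x s) (u s)) t) v) \<and>
              (\<forall>v\<in>IV N m. u t v = \<Psi> (jet \<beta> (IV N m) (\<lambda>s. first_substates N m (x s) (u s)) t) v)))"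
      by (rule exI[of _ r], rule exI[of _ "\<lambda>w v. \<Phi> w (Inl v)"], rule exI[of _ "\<lambda>w v. \<Phi> w (Inr v)"],
          rule exI[of _ W], intro conjI W ballI allI impI \<Phi>)
         (use traj in blast)+
  qed
qed

end

theorem theorem1:
  fixes N r :: nat and m :: "nat \<Rightarrow> nat"
    and fbar :: "nat \<Rightarrow> nat \<Rightarrow> nat \<Rightarrow> (nat \<times> nat \<times> nat \<Rightarrow> real) \<Rightarrow> (nat \<times> nat \<Rightarrow> real) \<Rightarrow> real"
    and \<Delta> :: "nat \<Rightarrow> nat \<Rightarrow> nat \<Rightarrow> (nat \<times> nat \<times> nat \<Rightarrow> real) \<Rightarrow> real"
    and xs :: "nat \<times> nat \<times> nat \<Rightarrow> real" and us :: "nat \<times> nat \<Rightarrow> real"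
  assumes "N \<ge> 1" and "r \<ge> 1"
    and "xs \<in> pts (SV N r m)" and "us \<in> pts (IV N m)"
    and "pure_feedback N r m fbar"
    and "regular N r m fbar xs us"
    and "\<exists>X0. opn (SV N r m <+> IV N m) X0 \<and> xu xs us \<in> X0 \<and> lower_triangular N r m \<Delta> X0"
  shows "\<exists>X. opn (SV N r m <+> IV N m) X \<and> xu xs us \<in> X \<and>
           diff_flat_on (SV N r m) (IV N m) (IV N m) (coupled_dyn fbar \<Delta>) X (first_substates N m)"
proof -
  let ?V = "SV N r m <+> IV N m"
  let ?I = "{..<N} \<times> {1..r}"
  obtain X0 where X0: "opn ?V X0" "xu xs us \<in> X0" "lower_triangular N r m \<Delta> X0"
    using assms(7) by blast
  have "\<forall>ij\<in>?I. \<exists>U. opn ?V U \<and> xu xs us \<in> U \<and>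
      (\<forall>k<m (fst ij). smooth_on ?V U (\<lambda>z. fbar (fst ij) (snd ij) k (z \<circ> Inl) (z \<circ> Inr)))"
    using assms(6) unfolding regular_def by auto
  from bchoice[OF this] obtain U where U: "\<forall>ij\<in>?I. opn ?V (U ij) \<and> xu xs us \<in> U ij \<and>
      (\<forall>k<m (fst ij). smooth_on ?V (U ij) (\<lambda>z. fbar (fst ij) (snd ij) k (z \<circ> Inl) (z \<circ> Inr)))"
    by (rule exE)
  \<comment> \<open>Regularity gives one neighbourhood for each pair \<open>(i, j)\<close>; these
    are finitely many, so their intersection with \<open>X0\<close> is still open.\<close>
  define Y where "Y = X0 \<inter> (pts ?V \<inter> (\<Inter>ij\<in>?I. U ij))"
  interpret coupled_system N r m fbar \<Delta> xs us Y
  proof (rule coupled_system.intro[OF assms(2,5,6)])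
    show "opn ?V Y" unfolding Y_def by (intro opn_Int X0(1) opn_finite_INT) (use U in auto)
    show "xu xs us \<in> Y" unfolding Y_def using X0(2) opn_ptsD[OF X0(1,2)] U by auto
    show "smooth_on ?V Y (\<lambda>z. fbar i j k (z \<circ> Inl) (z \<circ> Inr))" if "i < N" "1 \<le> j" "j \<le> r" "k < m i" for i j k
    proof (rule smooth_on_subset)
      have "(i, j) \<in> ?I" using that by simp
      then show "Y \<subseteq> U (i, j)" unfolding Y_def by blast
      show "smooth_on ?V (U (i, j)) (\<lambda>z. fbar i j k (z \<circ> Inl) (z \<circ> Inr))"
        using bspec[OF U \<open>(i, j) \<in> ?I\<close>] that(4) by simp
    qed
    show "lower_triangular N r m \<Delta> Y"
    proof -
      have "Y \<subseteq> X0" by (auto simp: Y_def)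
      then show ?thesis using X0(3) unfolding lower_triangular_def by (meson subsetD)
    qed
  qed
  show ?thesis by (rule coupled_flat)
qed

end
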